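(* Let $k$ be an algebraically closed field, let $n\ge 3$, and let $k[\mathbf{z}]=k[z_1,\ldots,z_n]$. Let $l\le m$ be positive integers, let $\mathbf{F}\in k[\mathbf{z}]^{l\times m}$ be a matrix of rank $r$ with $1\le r\le l$, and let $\mathbf{F}_1\in k[\mathbf{z}]^{r\times m}$ be an arbitrary full row rank submatrix of $\mathbf{F}$ (that is, $\mathbf{F}_1$ consists of $r$ rows of $\mathbf{F}$ and has rank $r$). Then the following are equivalent: 1. $\mathbf{F}$ has an MLP factorization; 2. $\rho(\mathbf{F}_1):d_r(\mathbf{F}_1)$ is a free $k[\mathbf{z}]$-module of rank $r$.
   Context: Notation: $k[\mathbf{z}]^{l\times m}$ is the set of $l\times m$ matrices with entries in $k[\mathbf{z}]$. The rank of a matrix over $k[\mathbf{z}]$ is its rank over the fraction field of $k[\mathbf{z}]$; a matrix with $r$ rows is of full row rank if its rank is $r$. For a polynomial matrix $\mathbf{A}$, $d_i(\mathbf{A})$ denotes the greatest common divisor in $k[\mathbf{z}]$ of all the $i\times i$ minors of $\mathbf{A}$ (well defined up to a nonzero constant factor). A full row rank matrix $\mathbf{A}\in k[\mathbf{z}]^{r\times m}$ (with $r\le m$) is called minor left prime (MLP) if all its $r\times r$ minors are relatively prime, i.e. $d_r(\mathbf{A})$ is a nonzero constant. A matrix $\mathbf{F}\in k[\mathbf{z}]^{l\times m}$ of rank $r$, $1\le r\le l$, is said to have (admit) an MLP factorization if $\mathbf{F}=\mathbf{G}_0\mathbf{F}_0$ for some $\mathbf{G}_0\in k[\mathbf{z}]^{l\times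 r}$ and some MLP matrix $\mathbf{F}_0\in k[\mathbf{z}]^{r\times m}$. For a matrix $\mathbf{A}$ with $m$ columns, $\rho(\mathbf{A})$ denotes the $k[\mathbf{z}]$-submodule of $k[\mathbf{z}]^{1\times m}$ generated by the rows of $\mathbf{A}$. For a submodule $\mathcal{K}\subseteq k[\mathbf{z}]^{1\times m}$ and a nonzero ideal $J$ of $k[\mathbf{z}]$, $\mathcal{K}:J=\{\vec{u}\in k[\mathbf{z}]^{1\times m}\mid J\vec{u}\subseteq\mathcal{K}\}$, where $J\vec{u}=\{f\vec{u}\mid f\in J\}$. For a nonzero polynomial $f$, $\mathcal{K}:f$ means $\mathcal{K}:\langle f\rangle$, i.e. $\{\vec{u}\in k[\mathbf{z}]^{1\times m}\mid f\vec{u}\in\mathcal{K}\}$. *)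

theory Defs
  imports
    "HOL-Library.Cardinality"
    "HOL-Library.Poly_Mapping"
    "HOL-Computational_Algebra.Polynomial_Factorial"
    "Jordan_Normal_Form.DL_Rank"
    "Jordan_Normal_Form.DL_Submatrix"
begin

(* The polynomial ring k[z_1, ..., z_n]: the variables are indexed by the type 'v, so
   n = CARD('v) for finite 'v.  Ordering the index type (any finite type can be ordered)
   is what makes the library's idom instance for this type available. *)
type_synonym ('v, 'k) mpolynomial = "('v \<Rightarrow>\<^sub>0 nat) \<Rightarrow>\<^sub>0 'k"

definition is_constant :: "('v, 'k::zero) mpolynomial \<Rightarrow> bool" where
  "is_constant p \<longleftrightarrow> (\<exists>c. p = Poly_Mapping.single 0 c)"

definition fract_rank :: "'a::idom mat \<Rightarrow> nat" where
  "fract_rank A = vec_space.rank (dim_row A) (map_mat to_fract A)"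

definition full_row_rank :: "'a::idom mat \<Rightarrow> bool" where
  "full_row_rank A \<longleftrightarrow> fract_rank A = dim_row A"

definition minors :: "nat \<Rightarrow> 'a::comm_ring_1 mat \<Rightarrow> 'a set" where
  "minors i A = {det (submatrix A I J) | I J.
     I \<subseteq> {..<dim_row A} \<and> J \<subseteq> {..<dim_col A} \<and> card I = i \<and> card J = i}"

definition is_gcd_of :: "'a::comm_ring_1 set \<Rightarrow> 'a \<Rightarrow> bool" where
  "is_gcd_of S d \<longleftrightarrow> (\<forall>s\<in>S. d dvd s) \<and> (\<forall>e. (\<forall>s\<in>S. e dvd s) \<longrightarrow> e dvd d)"

(* d_i(A).  A gcd is only determined up to a unit; an arbitrary one is chosen.  Neither
   being a nonzero constant nor the quotient module K : d depends on the choice. *)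
definition minor_gcd :: "nat \<Rightarrow> 'a::comm_ring_1 mat \<Rightarrow> 'a" where
  "minor_gcd i A = (SOME d. is_gcd_of (minors i A) d)"

definition minor_left_prime :: "('v::linorder, 'k::field) mpolynomial mat \<Rightarrow> bool" where
  "minor_left_prime A \<longleftrightarrow> full_row_rank A \<and> dim_row A \<le> dim_col A \<and>
     minor_gcd (dim_row A) A \<noteq> 0 \<and> is_constant (minor_gcd (dim_row A) A)"

definition has_mlp_factorization :: "('v::linorder, 'k::field) mpolynomial mat \<Rightarrow> bool" where
  "has_mlp_factorization F \<longleftrightarrow>
     (\<exists>G\<^sub>0 \<in> carrier_mat (dim_row F) (fract_rank F).
      \<exists>F\<^sub>0 \<in> carrier_mat (fract_rank F) (dim_col F).
        minor_left_prime F\<^sub>0 \<and> F = G\<^sub>0 * F\<^sub>0)"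

(* Linear combinations in the module R^m of vectors over a commutative ring R. *)
abbreviation vec_span :: "nat \<Rightarrow> 'a::comm_ring_1 vec set \<Rightarrow> 'a vec set" where
  "vec_span m \<equiv> LinearCombinations.module.span class_ring (module_vec TYPE('a) m)"

abbreviation vec_lin_indpt :: "nat \<Rightarrow> 'a::comm_ring_1 vec set \<Rightarrow> bool" where
  "vec_lin_indpt m B \<equiv>
     \<not> LinearCombinations.module.lin_dep class_ring (module_vec TYPE('a) m) B"

definition row_module :: "'a::comm_ring_1 mat \<Rightarrow> 'a vec set" where
  "row_module A = vec_span (dim_col A) (set (rows A))"

definition colon :: "nat \<Rightarrow> 'a::comm_ring_1 vec set \<Rightarrow> 'a \<Rightarrow> 'a vec set" where
  "colon m K f = {u \<in> carrier_vec m. f \<cdot>\<^sub>v u \<in> K}"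

definition free_of_rank :: "nat \<Rightarrow> 'a::comm_ring_1 vec set \<Rightarrow> nat \<Rightarrow> bool" where
  "free_of_rank m K r \<longleftrightarrow>
     (\<exists>B \<subseteq> carrier_vec m. finite B \<and> card B = r \<and> vec_lin_indpt m B \<and> vec_span m B = K)"

end

theory Submission
  imports Defs
begin

text \<open>
  Write \<open>F\<^sub>1\<close> for the chosen rows, \<open>d\<close> for the gcd of their maximal minors and \<open>K = \<rho>(F\<^sub>1) : d\<close>.
  Cramer's rule shows that \<open>c u = w F\<^sub>1\<close> forces \<open>c\<close> to divide \<open>w d\<close>; hence \<open>f u \<in> K\<close> with \<open>f \<noteq> 0\<close>
  implies \<open>u \<in> K\<close>, and \<open>K = \<rho>(F\<^sub>0)\<close> whenever \<open>F\<^sub>1 = G\<^sub>1 F\<^sub>0\<close> with \<open>F\<^sub>0\<close> minor left prime.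
  Conversely let the rows of \<open>F\<^sub>0\<close> be a basis of \<open>K\<close>.  Every row of \<open>F\<close> has a nonzero multiple in
  \<open>\<rho>(F\<^sub>1)\<close>, hence lies in \<open>K\<close>, so \<open>F = G\<^sub>0 F\<^sub>0\<close>.  Let \<open>e\<close> be the gcd of the maximal minors of
  \<open>F\<^sub>0\<close>.  For a maximal square submatrix \<open>A\<close> the entries of \<open>adj(A) F\<^sub>0\<close> are maximal minors up to sign
  or zero, so they are divisible by \<open>e\<close>; since \<open>K\<close> is saturated, \<open>e\<close> divides \<open>adj(A)\<close>.  Taking
  determinants, \<open>e\<close> divides \<open>(det A / e)^r\<close> for every \<open>A\<close>, although the quotients \<open>det A / e\<close> have no
  common factor, so \<open>e\<close> is a unit.  Only the existence of gcds in \<open>k[z]\<close> is needed; it follows from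
  Gauss's lemma by adjoining one variable at a time.
\<close>

section \<open>Greatest common divisors over polynomial rings\<close>

text \<open>The polynomial rings in varying sets of variables all live in one type, so they are
  handled as carrier sets \<open>A\<close>; the \<open>dvd\<close> of the type would also accept
  quotients outside \<open>A\<close>.\<close>

definition dvd_in :: "'a::comm_ring_1 set \<Rightarrow> 'a \<Rightarrow> 'a \<Rightarrow> bool" where
  "dvd_in A a b \<longleftrightarrow> (\<exists>q\<in>A. b = a * q)"

definition gcd_in :: "'a::comm_ring_1 set \<Rightarrow> 'a \<Rightarrow> 'a \<Rightarrow> 'a \<Rightarrow> bool" where
  "gcd_in A a b d \<longleftrightarrow> d \<in> A \<and> dvd_in A d a \<and> dvd_in A d b \<and>
     (\<forall>e\<in>A. dvd_in A e a \<longrightarrow> dvd_in A e b \<longrightarrow> dvd_in A e d)"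

definition polys_over :: "'a::comm_ring_1 set \<Rightarrow> 'a poly set" where
  "polys_over A = {p. \<forall>i. coeff p i \<in> A}"

locale ring_subset =
  fixes A :: "'a::idom set"
  assumes zero_mem [simp, intro]: "0 \<in> A"
    and one_mem [simp, intro]: "1 \<in> A"
    and add_mem [intro]: "a \<in> A \<Longrightarrow> b \<in> A \<Longrightarrow> a + b \<in> A"
    and diff_mem [intro]: "a \<in> A \<Longrightarrow> b \<in> A \<Longrightarrow> a - b \<in> A"
    and mult_mem [intro]: "a \<in> A \<Longrightarrow> b \<in> A \<Longrightarrow> a * b \<in> A"
begin

lemma dvd_in_refl [simp, intro]: "dvd_in A a a"
  unfolding dvd_in_def by (rule bexI[of _ 1]) auto

lemma dvd_in_zero [simp, intro]: "dvd_in A a 0"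
  unfolding dvd_in_def by (rule bexI[of _ 0]) auto

lemma one_dvd_in [simp]: "a \<in> A \<Longrightarrow> dvd_in A 1 a"
  unfolding dvd_in_def by auto

lemma dvd_in_trans [trans]: "dvd_in A a b \<Longrightarrow> dvd_in A b c \<Longrightarrow> dvd_in A a c"
  unfolding dvd_in_def by (auto simp: mult.assoc)

lemma dvd_in_add: "dvd_in A a b \<Longrightarrow> dvd_in A a c \<Longrightarrow> dvd_in A a (b + c)"
  unfolding dvd_in_def by (metis add_mem distrib_left)

lemma dvd_in_diff: "dvd_in A a b \<Longrightarrow> dvd_in A a c \<Longrightarrow> dvd_in A a (b - c)"
  unfolding dvd_in_def by (metis diff_mem right_diff_distrib)

lemma dvd_in_mult: "dvd_in A a b \<Longrightarrow> c \<in> A \<Longrightarrow> dvd_in A a (b * c)"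
  unfolding dvd_in_def by (auto simp: mult.assoc)

lemma dvd_in_mult2: "dvd_in A a b \<Longrightarrow> c \<in> A \<Longrightarrow> dvd_in A a (c * b)"
  using dvd_in_mult[of a b c] by (simp add: mult.commute)

lemma dvd_in_mult_mono: "dvd_in A a b \<Longrightarrow> dvd_in A c d \<Longrightarrow> dvd_in A (a * c) (b * d)"
  unfolding dvd_in_def by (metis mult.assoc mult.left_commute mult_mem)

lemma dvd_in_cancel: "c \<noteq> 0 \<Longrightarrow> dvd_in A (c * a) (c * b) \<Longrightarrow> dvd_in A a b"
  unfolding dvd_in_def by (auto simp: mult.assoc)

lemma dvd_in_sum: "(\<And>x. x \<in> X \<Longrightarrow> dvd_in A a (f x)) \<Longrightarrow> dvd_in A a (sum f X)"
  by (induction X rule: infinite_finite_induct) (auto intro: dvd_in_add)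

lemma sum_mem: "(\<And>x. x \<in> X \<Longrightarrow> f x \<in> A) \<Longrightarrow> sum f X \<in> A"
  by (induction X rule: infinite_finite_induct) auto

lemma dvd_in_mem: "a \<in> A \<Longrightarrow> dvd_in A a b \<Longrightarrow> b \<in> A"
  unfolding dvd_in_def by auto

lemma polys_over_0 [simp]: "0 \<in> polys_over A"
  and polys_over_1 [simp]: "1 \<in> polys_over A"
  and polys_over_add: "p \<in> polys_over A \<Longrightarrow> q \<in> polys_over A \<Longrightarrow> p + q \<in> polys_over A"
  and polys_over_diff: "p \<in> polys_over A \<Longrightarrow> q \<in> polys_over A \<Longrightarrow> p - q \<in> polys_over A"
  and polys_over_mult: "p \<in> polys_over A \<Longrightarrow> q \<in> polys_over A \<Longrightarrow> p * q \<in> polys_over A"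
  and polys_over_smult: "c \<in> A \<Longrightarrow> p \<in> polys_over A \<Longrightarrow> Polynomial.smult c p \<in> polys_over A"
  and polys_over_monom: "c \<in> A \<Longrightarrow> monom c n \<in> polys_over A"
  by (auto simp: polys_over_def coeff_mult coeff_1 intro!: sum_mem)

lemmas polys_over_intros =
  polys_over_add polys_over_diff polys_over_mult polys_over_smult polys_over_monom

lemma pCons_in_polys_over: "pCons a p \<in> polys_over A \<longleftrightarrow> a \<in> A \<and> p \<in> polys_over A"
  by (auto simp: polys_over_def coeff_pCons split: nat.splits)

lemma ring_subset_polys: "ring_subset (polys_over A)"
  by unfold_locales (auto intro: polys_over_intros)

end

locale gcd_subring = ring_subset A for A :: "'a::idom set" +
  assumes gcd_ex: "a \<in> A \<Longrightarrow> b \<in> A \<Longrightarrow> \<exists>d. gcd_in A a b d"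
begin

text \<open>This is gcd(ca, cb) = c gcd(a, b): a gcd \<open>h\<close> of the scaled pair is a
  multiple \<open>c * t\<close> of \<open>c\<close>, and cancelling \<open>c\<close> shows that
  \<open>t\<close> divides \<open>a\<close> and \<open>b\<close>, hence \<open>d\<close>. So
  \<open>e\<close> divides \<open>h\<close>, which divides \<open>c * d\<close>.\<close>

lemma dvd_in_scaled_gcd:
  assumes g: "gcd_in A a b d" and c: "c \<in> A" and ab: "a \<in> A" "b \<in> A"
    and e: "e \<in> A" "dvd_in A e (c * a)" "dvd_in A e (c * b)"
  shows "dvd_in A e (c * d)"
proof (cases "c = 0")
  case False
  obtain h where h: "gcd_in A (c * a) (c * b) h" using gcd_ex c ab by blast
  have "dvd_in A c h"
    using h c ab unfolding gcd_in_def dvd_in_def by blast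
  then obtain t where t: "t \<in> A" "h = c * t" unfolding dvd_in_def by blast
  have "dvd_in A t a" "dvd_in A t b"
    using h t False dvd_in_cancel unfolding gcd_in_def by auto
  then have "dvd_in A t d" using g t unfolding gcd_in_def by blast
  then have "dvd_in A h (c * d)" using t dvd_in_mult_mono[of c c t d] by simp
  moreover have "dvd_in A e h" using h e unfolding gcd_in_def by blast
  ultimately show ?thesis using dvd_in_trans by blast
qed simp

text \<open>Euclid's lemma: \<open>c\<close> divides both \<open>b * c\<close> and
  \<open>b * a\<close>, hence \<open>b\<close> times the gcd of \<open>c\<close> and
  \<open>a\<close>, which is 1.\<close>

lemma coprime_dvd_in_mult:
  assumes g: "gcd_in A c a 1" and "a \<in> A" "b \<in> A" "c \<in> A" and d: "dvd_in A c (a * b)"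
  shows "dvd_in A c b"
proof -
  have "dvd_in A c (b * 1)"
    by (rule dvd_in_scaled_gcd[OF g]) (use assms in \<open>auto simp: mult.commute dvd_in_mult2\<close>)
  then show ?thesis by simp
qed

lemma gcd_in_unit:
  assumes "gcd_in A a b d" "dvd_in A d 1"
  shows "gcd_in A a b 1"
  using assms dvd_in_trans unfolding gcd_in_def
  by (meson dvd_in_mem one_dvd_in one_mem)

section \<open>Contents, primitive polynomials and Gauss's lemma\<close>

definition const_dvd :: "'a \<Rightarrow> 'a poly \<Rightarrow> bool" where
  "const_dvd c p \<longleftrightarrow> (\<forall>i. dvd_in A c (coeff p i))"

definition primitive :: "'a poly \<Rightarrow> bool" where
  "primitive p \<longleftrightarrow> p \<in> polys_over A \<and> (\<forall>c\<in>A. const_dvd c p \<longrightarrow> dvd_in A c 1)"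

lemma primitive_nonzero: "primitive p \<Longrightarrow> p \<noteq> 0"
  unfolding primitive_def const_dvd_def dvd_in_def by force

lemma const_dvd_mult: "const_dvd c p \<Longrightarrow> q \<in> polys_over A \<Longrightarrow> const_dvd c (p * q)"
  unfolding const_dvd_def polys_over_def coeff_mult
  by (auto intro!: dvd_in_sum dvd_in_mult)

lemma const_dvd_iff:
  assumes "c \<in> A"
  shows "const_dvd c p \<longleftrightarrow> (\<exists>q\<in>polys_over A. p = Polynomial.smult c q)"
proof
  assume "const_dvd c p"
  then show "\<exists>q\<in>polys_over A. p = Polynomial.smult c q"
  proof (induction p)
    case (pCons a p)
    have "dvd_in A c a" "const_dvd c p"
      using pCons.prems unfolding const_dvd_def
      by (metis coeff_pCons_0, metis coeff_pCons_Suc)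
    then obtain q b where "q \<in> polys_over A" "p = Polynomial.smult c q" "b \<in> A" "a = c * b"
      using pCons.IH unfolding dvd_in_def by auto
    then show ?case
      by (intro bexI[of _ "pCons b q"]) (auto simp: pCons_in_polys_over)
  qed auto
qed (auto simp: const_dvd_def dvd_in_def polys_over_def)

text \<open>The content is built coefficient by coefficient: for \<open>pCons a p\<close> it is a
  gcd of \<open>a\<close> and the content of \<open>p\<close>.\<close>

lemma content_ex:
  assumes "p \<in> polys_over A"
  shows "\<exists>c\<in>A. const_dvd c p \<and> (\<forall>e\<in>A. const_dvd e p \<longrightarrow> dvd_in A e c)"
  using assms
proof (induction p)
  case 0
  have "const_dvd e 0" for e by (simp add: const_dvd_def)
  then show ?case using dvd_in_zero zero_mem by blast
next
  case (pCons a p)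
  have mem: "a \<in> A" "p \<in> polys_over A" using pCons.prems by (simp_all add: pCons_in_polys_over)
  then obtain c where c: "c \<in> A" "const_dvd c p" "\<forall>e\<in>A. const_dvd e p \<longrightarrow> dvd_in A e c"
    using pCons.IH by blast
  have split: "const_dvd e (pCons a p) \<longleftrightarrow> dvd_in A e a \<and> const_dvd e p" for e
    unfolding const_dvd_def by (auto simp: coeff_pCons split: nat.split)
  obtain d where d: "gcd_in A a c d" using gcd_ex mem c by blast
  show ?case
  proof (rule bexI[of _ d])
    have "const_dvd d p" using c d unfolding const_dvd_def gcd_in_def by (meson dvd_in_trans)
    then show "const_dvd d (pCons a p) \<and> (\<forall>e\<in>A. const_dvd e (pCons a p) \<longrightarrow> dvd_in A e d)"
      using c d unfolding gcd_in_def split by blast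
  qed (use d in \<open>auto simp: gcd_in_def\<close>)
qed

lemma primitive_part_ex:
  assumes p: "p \<in> polys_over A" "p \<noteq> 0"
  obtains c q where "c \<in> A" "c \<noteq> 0" "p = Polynomial.smult c q" "primitive q"
proof -
  obtain c where c: "c \<in> A" "const_dvd c p" "\<forall>e\<in>A. const_dvd e p \<longrightarrow> dvd_in A e c"
    using content_ex p by blast
  then obtain q where q: "q \<in> polys_over A" "p = Polynomial.smult c q" using const_dvd_iff by blast
  have c0: "c \<noteq> 0" using q p by auto
  have "primitive q" unfolding primitive_def
  proof (intro conjI ballI impI)
    fix e assume e: "e \<in> A" "const_dvd e q"
    \<comment> \<open>A constant divisor \<open>e\<close> of the quotient \<open>q\<close> gives the
      constant divisor \<open>c * e\<close> of \<open>p\<close>, which must divide the content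
      \<open>c\<close>.\<close>
    then have "const_dvd (c * e) p"
      unfolding q const_dvd_def by (auto intro: dvd_in_mult_mono)
    then have "dvd_in A (c * e) (c * 1)" using c e by auto
    then show "dvd_in A e 1" using c0 dvd_in_cancel by blast
  qed fact
  then show thesis using that c c0 q by blast
qed

text \<open>The content of the scaled polynomial is \<open>t\<close> up to a unit: it is a multiple
  \<open>t * s\<close>, and then \<open>s\<close> divides every coefficient of the primitive
  \<open>h\<close>, so \<open>s\<close> is a unit.\<close>

lemma const_dvd_smult_primitive:
  assumes h: "primitive h" and t: "t \<in> A" and d: "d \<in> A" "const_dvd d (Polynomial.smult t h)"
  shows "dvd_in A d t"
proof (cases "t = 0")
  case False
  have hA: "h \<in> polys_over A" using h by (simp add: primitive_def)
  obtain g where g: "g \<in> A" "const_dvd g (Polynomial.smult t h)"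
    "\<forall>e\<in>A. const_dvd e (Polynomial.smult t h) \<longrightarrow> dvd_in A e g"
    using content_ex[OF polys_over_smult[OF t hA]] by blast
  have "dvd_in A t g" using g(3) t hA const_dvd_iff[OF t] by blast
  then obtain s where s: "s \<in> A" "g = t * s" unfolding dvd_in_def by blast
  have "const_dvd s h"
    using g(2) False dvd_in_cancel unfolding s const_dvd_def by auto
  then have "dvd_in A s 1" using h s by (simp add: primitive_def)
  then have "dvd_in A g t" using dvd_in_mult_mono[of t t s 1] s by simp
  then show ?thesis using g(3) d dvd_in_trans by blast
qed simp

text \<open>Without primes: a constant dividing the product is made coprime to both leading
  coefficients by deleting the leading term of either factor.\<close>

lemma primitive_mult:
  "primitive f \<Longrightarrow> primitive g \<Longrightarrow> primitive (f * g)"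
proof (induction "degree f + degree g" arbitrary: f g rule: less_induct)
  case less
  \<comment> \<open>The induction hypothesis enters as the assumption \<open>IH\<close>, so that the
    same argument also serves with the two factors exchanged.\<close>
  have coprime_lead: "gcd_in A c (lead_coeff f) 1"
    if fg: "primitive f" "primitive g" and c: "c \<in> A" "const_dvd c (f * g)"
      and IH: "\<And>f'. degree f' < degree f \<Longrightarrow> primitive f' \<Longrightarrow> primitive (f' * g)" for c f g
  proof -
    define a where "a = lead_coeff f"
    have A: "f \<in> polys_over A" "g \<in> polys_over A" "a \<in> A"
      using fg unfolding primitive_def polys_over_def a_def by auto
    obtain d where d: "gcd_in A c a d" using gcd_ex A c by blast
    have dA: "d \<in> A" "dvd_in A d c" "dvd_in A d a" using d by (auto simp: gcd_in_def)
    \<comment> \<open>\<open>d\<close> divides \<open>f * g\<close> and the leading term of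
      \<open>f\<close>, hence \<open>f' * g\<close>. The product of \<open>g\<close> with the
      primitive part of \<open>f'\<close> is primitive by \<open>IH\<close>, so \<open>d\<close>
      divides the content of \<open>f'\<close>, thus \<open>f'\<close> and finally \<open>f\<close>;
      as \<open>f\<close> is primitive, \<open>d\<close> is a unit.\<close>
    define f' where "f' = f - monom a (degree f)"
    have f'A: "f' \<in> polys_over A" unfolding f'_def by (intro polys_over_intros A)
    have da: "const_dvd d (monom a n)" for n using dA by (simp add: const_dvd_def)
    have "const_dvd d f'"
    proof (cases "f' = 0")
      case False
      have "f' = 0 \<or> degree f' < degree f"
      proof (cases "degree f = 0")
        case True
        then show ?thesis unfolding f'_def a_def
          by (metis degree_eq_zeroE diff_self lead_coeff_pCons(2) monom_0 degree_pCons_0 coeff_pCons_0)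
      next
        case False
        have "degree f' \<le> degree f"
          unfolding f'_def by (intro degree_diff_le) (auto intro: degree_monom_le)
        moreover have "coeff f' (degree f) = 0" by (simp add: f'_def a_def)
        ultimately show ?thesis using False
          by (metis le_neq_implies_less leading_coeff_0_iff)
      qed
      with False have deg: "degree f' < degree f" by blast
      obtain t h where t: "t \<in> A" "t \<noteq> 0" "f' = Polynomial.smult t h" "primitive h"
        using primitive_part_ex[OF f'A False] by blast
      have "primitive (h * g)" using IH t deg by simp
      moreover have "const_dvd d (Polynomial.smult t (h * g))"
      proof -
        have "Polynomial.smult t (h * g) = f * g - monom a (degree f) * g"
          by (simp only: mult_smult_left[symmetric] t(3)[symmetric] f'_def left_diff_distrib)
        moreover have "const_dvd d (f * g)"
          using c dA dvd_in_trans unfolding const_dvd_def by blast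
        moreover have "const_dvd d (monom a (degree f) * g)"
          using const_dvd_mult[OF da A(2)] .
        ultimately show ?thesis unfolding const_dvd_def by (auto intro: dvd_in_diff)
      qed
      ultimately have "dvd_in A d t" using const_dvd_smult_primitive t dA by blast
      moreover have "h \<in> polys_over A" using t by (simp add: primitive_def)
      ultimately show ?thesis
        unfolding t(3) const_dvd_def polys_over_def by (auto intro: dvd_in_mult)
    qed (simp add: const_dvd_def)
    moreover have "f = f' + monom a (degree f)" by (simp add: f'_def)
    ultimately have "const_dvd d f"
      using da unfolding const_dvd_def by (metis coeff_add dvd_in_add)
    then have "dvd_in A d 1" using fg dA by (simp add: primitive_def)
    then show ?thesis using d gcd_in_unit a_def by blast
  qed
  have fgA: "f \<in> polys_over A" "g \<in> polys_over A"
    using less.prems by (auto simp: primitive_def)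
  show ?case unfolding primitive_def
  proof (intro conjI ballI impI)
    show "f * g \<in> polys_over A" using fgA polys_over_mult by blast
    fix c assume c: "c \<in> A" "const_dvd c (f * g)"
    have 1: "gcd_in A c (lead_coeff f) 1"
      by (rule coprime_lead[of f g]) (use less c in auto)
    have 2: "gcd_in A c (lead_coeff g) 1"
      by (rule coprime_lead[of g f])
         (use less c in \<open>auto simp: mult.commute[of g f] mult.commute[of _ f]\<close>)
    \<comment> \<open>This product is the leading coefficient of \<open>f * g\<close>. Coprimality
      with the first factor moves \<open>c\<close> onto the second, to which it is coprime as
      well.\<close>
    have "dvd_in A c (lead_coeff f * lead_coeff g)"
      using c(2) unfolding const_dvd_def by (metis lead_coeff_mult)
    then have "dvd_in A c (lead_coeff g)"
      using 1 c fgA coprime_dvd_in_mult unfolding polys_over_def by blast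
    then show "dvd_in A c 1" using 2 c unfolding gcd_in_def by blast
  qed
qed

text \<open>If \<open>q'\<close> is the primitive part of \<open>q\<close> and \<open>t\<close> its
  content, then \<open>h * q'\<close> is primitive by Gauss's lemma, so \<open>t\<close> is also the
  content of \<open>h * q\<close>.\<close>

lemma const_dvd_primitive_mult:
  assumes h: "primitive h" and q: "q \<in> polys_over A" and c: "c \<in> A" "const_dvd c (h * q)"
  shows "const_dvd c q"
proof (cases "q = 0")
  case False
  obtain t q' where t: "t \<in> A" "q = Polynomial.smult t q'" "primitive q'"
    using primitive_part_ex[OF q False] by blast
  have "primitive (h * q')" using primitive_mult h t by blast
  then have "dvd_in A c t" using const_dvd_smult_primitive[of "h * q'" t c] c t by simp
  moreover have "q' \<in> polys_over A" using t by (simp add: primitive_def)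
  ultimately show ?thesis unfolding t const_dvd_def polys_over_def by (auto intro: dvd_in_mult)
qed (simp add: const_dvd_def)

text \<open>Nonzero constants can be cancelled from divisibility by a primitive polynomial: in
  \<open>c f = h q\<close> the constant \<open>c\<close> divides \<open>h q\<close>, hence already
  \<open>q\<close>.\<close>

lemma primitive_dvd_smult:
  assumes h: "primitive h" and c: "c \<in> A" "c \<noteq> 0" and f: "f \<in> polys_over A"
    and d: "dvd_in (polys_over A) h (Polynomial.smult c f)"
  shows "dvd_in (polys_over A) h f"
proof -
  obtain q where q: "q \<in> polys_over A" "Polynomial.smult c f = h * q"
    using d unfolding dvd_in_def by blast
  have "const_dvd c (h * q)"
    using const_dvd_iff[OF c(1)] f unfolding q(2)[symmetric] by blast
  then have "const_dvd c q" using const_dvd_primitive_mult h q c by blast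
  then obtain s where s: "s \<in> polys_over A" "q = Polynomial.smult c s" using const_dvd_iff c by blast
  have "Polynomial.smult c f = Polynomial.smult c (h * s)" using q s by simp
  then have "Polynomial.smult c (f - h * s) = 0" by (simp add: smult_diff_right)
  then have "f = h * s" using c by simp
  then show ?thesis using s unfolding dvd_in_def by blast
qed

lemma primitive_dvd:
  assumes "primitive f" "h \<in> polys_over A" "dvd_in (polys_over A) h f"
  shows "primitive h"
  using assms const_dvd_mult unfolding primitive_def dvd_in_def by blast

section \<open>Pseudo-division and the Euclidean algorithm\<close>

lemma pseudo_division:
  assumes "f \<in> polys_over A" "g \<in> polys_over A" "g \<noteq> 0"
  shows "\<exists>c q r. c \<in> A \<and> c \<noteq> 0 \<and> q \<in> polys_over A \<and> r \<in> polys_over A \<and>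
    Polynomial.smult c f = g * q + r \<and> (r = 0 \<or> degree r < degree g)"
  using assms(1)
proof (induction "degree f" arbitrary: f rule: less_induct)
  case less
  show ?case
  proof (cases "f = 0 \<or> degree f < degree g")
    case True
    then show ?thesis using less.prems
      by (intro exI[of _ 1] exI[of _ 0] exI[of _ f]) auto
  next
    case False
    define a b n where "a = lead_coeff f" and "b = lead_coeff g" and "n = degree f - degree g"
    have ab: "a \<in> A" "b \<in> A" "b \<noteq> 0"
      using less.prems assms by (auto simp: a_def b_def polys_over_def)
    \<comment> \<open>Scaling \<open>f\<close> by the leading coefficient of \<open>g\<close> makes
      the leading terms cancel without any division in \<open>A\<close>; these scalings accumulate
      in \<open>c\<close>.\<close>
    define f' where "f' = Polynomial.smult b f - g * monom a n"
    have f'A: "f' \<in> polys_over A"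
      unfolding f'_def by (intro polys_over_intros less.prems assms ab)
    have "\<exists>c q r. c \<in> A \<and> c \<noteq> 0 \<and> q \<in> polys_over A \<and> r \<in> polys_over A \<and>
      Polynomial.smult c f' = g * q + r \<and> (r = 0 \<or> degree r < degree g)"
    proof (cases "f' = 0")
      case True
      then show ?thesis by (intro exI[of _ 1] exI[of _ 0]) auto
    next
      case nz: False
      have "degree (g * monom a n) \<le> degree f"
        using degree_mult_le[of g "monom a n"] degree_monom_le[of a n] False
        unfolding n_def by linarith
      then have le: "degree f' \<le> degree f"
        unfolding f'_def by (intro degree_diff_le) auto
      have "coeff (g * monom a n) (degree f) = b * a"
        using False by (auto simp: n_def b_def mult.commute[of g] coeff_monom_mult)
      then have "coeff f' (degree f) = 0" by (simp add: f'_def a_def)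
      then have "degree f' < degree f"
        using le nz by (metis le_neq_implies_less leading_coeff_0_iff)
      then show ?thesis using less.hyps f'A by blast
    qed
    then obtain c q r where *: "c \<in> A" "c \<noteq> 0" "q \<in> polys_over A" "r \<in> polys_over A"
      "Polynomial.smult c f' = g * q + r" "r = 0 \<or> degree r < degree g" by blast
    have "Polynomial.smult (c * b) f = Polynomial.smult c f' + g * Polynomial.smult c (monom a n)"
      by (simp add: f'_def smult_diff_right)
    then have "Polynomial.smult (c * b) f = g * (q + Polynomial.smult c (monom a n)) + r"
      using *(5) by (simp add: algebra_simps)
    then show ?thesis using * ab
      by (intro exI[of _ "c * b"] exI[of _ "q + Polynomial.smult c (monom a n)"] exI[of _ r])
         (auto intro!: polys_over_intros)
  qed
qed

interpretation polys: ring_subset "polys_over A"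
  by (rule ring_subset_polys)

text \<open>Euclid's algorithm with each remainder replaced by its primitive part \<open>s\<close>.
  Divisors of primitive polynomials are primitive, so the constants \<open>c\<close> from
  pseudo-division and \<open>t\<close> from the content of the remainder can be cancelled.\<close>

lemma gcd_primitive_ex:
  "primitive g \<Longrightarrow> primitive f \<Longrightarrow> \<exists>h. gcd_in (polys_over A) f g h"
proof (induction "degree g" arbitrary: f g rule: less_induct)
  case less
  have fg: "f \<in> polys_over A" "g \<in> polys_over A" "g \<noteq> 0"
    using less.prems primitive_nonzero by (auto simp: primitive_def)
  obtain c q r where *: "c \<in> A" "c \<noteq> 0" "q \<in> polys_over A" "r \<in> polys_over A"
      "Polynomial.smult c f = g * q + r" "r = 0 \<or> degree r < degree g"
    using pseudo_division[OF fg] by blast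
  have r: "r = Polynomial.smult c f - g * q" using * by simp
  show ?case
  proof (cases "r = 0")
    case True
    then have "dvd_in (polys_over A) g (Polynomial.smult c f)" using * unfolding dvd_in_def by auto
    then have "dvd_in (polys_over A) g f" using primitive_dvd_smult less.prems * fg by blast
    then have "gcd_in (polys_over A) f g g" using fg by (simp add: gcd_in_def)
    then show ?thesis ..
  next
    case False
    obtain t s where t: "t \<in> A" "t \<noteq> 0" "r = Polynomial.smult t s" "primitive s"
      using primitive_part_ex[OF *(4) False] by blast
    have sA: "s \<in> polys_over A" using t by (simp add: primitive_def)
    have "degree s < degree g" using t False * by auto
    then obtain h where h: "gcd_in (polys_over A) g s h" using less t by blast
    have hA: "h \<in> polys_over A" "dvd_in (polys_over A) h g" "dvd_in (polys_over A) h s"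
      using h by (auto simp: gcd_in_def)
    have hp: "primitive h" using primitive_dvd less.prems hA by blast
    \<comment> \<open>\<open>c f = g q + t s\<close> is a combination of \<open>g\<close> and
      \<open>s\<close>; the factor \<open>c\<close> is removed afterwards because \<open>h\<close>
      is primitive.\<close>
    have "dvd_in (polys_over A) h (Polynomial.smult c f)"
    proof -
      have "Polynomial.smult c f = g * q + s * [:t:]" using * t by simp
      moreover have "[:t:] \<in> polys_over A" using t polys_over_monom[of t 0] by (simp add: monom_0)
      ultimately show ?thesis using hA *(3)
        by (simp only:) (intro polys.dvd_in_add polys.dvd_in_mult)
    qed
    then have hf: "dvd_in (polys_over A) h f" using primitive_dvd_smult hp * fg by blast
    have "dvd_in (polys_over A) e h"
      if e: "e \<in> polys_over A" "dvd_in (polys_over A) e f" "dvd_in (polys_over A) e g" for e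
    proof -
      \<comment> \<open>This combination is \<open>t s\<close>; as a divisor of the primitive
        \<open>g\<close>, \<open>e\<close> is primitive and \<open>t\<close> cancels.\<close>
      have "dvd_in (polys_over A) e (f * [:c:] - g * q)"
        using e * polys_over_monom[of c 0]
        by (intro polys.dvd_in_diff polys.dvd_in_mult) (auto simp: monom_0)
      then have "dvd_in (polys_over A) e (Polynomial.smult t s)" using r t by simp
      then have "dvd_in (polys_over A) e s"
        using primitive_dvd_smult[OF primitive_dvd[OF less.prems(1) e(1,3)]] t sA by blast
      then show ?thesis using h e by (simp add: gcd_in_def)
    qed
    then have "gcd_in (polys_over A) f g h" using hA hf by (simp add: gcd_in_def)
    then show ?thesis ..
  qed
qed

text \<open>Gauss's lemma separates contents from primitive parts. The dividend must be nonzero,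
  since everything divides 0 whatever \<open>p'\<close> is.\<close>

lemma dvd_in_smult_iff:
  assumes "primitive p" "c \<in> A"
    and "primitive p'" "c' \<in> A" "c' \<noteq> 0"
  shows "dvd_in (polys_over A) (Polynomial.smult c p) (Polynomial.smult c' p') \<longleftrightarrow>
    dvd_in A c c' \<and> dvd_in (polys_over A) p p'"
proof
  assume d: "dvd_in (polys_over A) (Polynomial.smult c p) (Polynomial.smult c' p')"
  then obtain q where q: "q \<in> polys_over A" "Polynomial.smult c' p' = Polynomial.smult c p * q"
    unfolding dvd_in_def by blast
  have "p * q \<in> polys_over A" using assms q by (auto simp: primitive_def polys_over_mult)
  then have "const_dvd c (Polynomial.smult c' p')" unfolding q(2) using const_dvd_iff assms by auto
  then have "dvd_in A c c'" using const_dvd_smult_primitive assms by blast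
  moreover have "Polynomial.smult c' p' = p * Polynomial.smult c q" "Polynomial.smult c q \<in> polys_over A"
    using q assms by (simp_all add: polys_over_smult)
  then have "dvd_in (polys_over A) p (Polynomial.smult c' p')" unfolding dvd_in_def by blast
  then have "dvd_in (polys_over A) p p'"
    using primitive_dvd_smult[of p c' p'] assms unfolding primitive_def by blast
  ultimately show "dvd_in A c c' \<and> dvd_in (polys_over A) p p'" ..
next
  assume "dvd_in A c c' \<and> dvd_in (polys_over A) p p'"
  then obtain s q where "s \<in> A" "c' = c * s" "q \<in> polys_over A" "p' = p * q"
    unfolding dvd_in_def by blast
  then have "Polynomial.smult c' p' = Polynomial.smult c p * Polynomial.smult s q" "Polynomial.smult s q \<in> polys_over A"
    by (simp_all add: polys_over_smult mult.commute[of s c])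
  then show "dvd_in (polys_over A) (Polynomial.smult c p) (Polynomial.smult c' p')" unfolding dvd_in_def by blast
qed

text \<open>The gcd is the gcd of the contents times the gcd of the primitive parts; zero is treated
  apart because it has no primitive part.\<close>

lemma gcd_polys_ex:
  assumes f: "f \<in> polys_over A" and g: "g \<in> polys_over A"
  shows "\<exists>h. gcd_in (polys_over A) f g h"
proof (cases "f = 0 \<or> g = 0")
  case True
  have "gcd_in (polys_over A) 0 p p" "gcd_in (polys_over A) p 0 p" if "p \<in> polys_over A" for p
    using that by (simp_all add: gcd_in_def)
  with True f g show ?thesis by blast
next
  case False
  obtain a f' where a: "a \<in> A" "a \<noteq> 0" "f = Polynomial.smult a f'" "primitive f'"
    using primitive_part_ex[OF f] False by blast
  obtain b g' where b: "b \<in> A" "b \<noteq> 0" "g = Polynomial.smult b g'" "primitive g'"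
    using primitive_part_ex[OF g] False by blast
  obtain h where h: "gcd_in (polys_over A) f' g' h" using gcd_primitive_ex a b by blast
  obtain c where c: "gcd_in A a b c" using gcd_ex a b by blast
  have hp: "primitive h" using h a primitive_dvd unfolding gcd_in_def by blast
  have c': "c \<in> A" "c \<noteq> 0" using c a unfolding gcd_in_def dvd_in_def by auto
  have "dvd_in (polys_over A) e (Polynomial.smult c h)"
    if e: "e \<in> polys_over A" "dvd_in (polys_over A) e f" "dvd_in (polys_over A) e g" for e
  proof -
    have "e \<noteq> 0" using e(2) False unfolding dvd_in_def by auto
    then obtain s e' where s: "s \<in> A" "s \<noteq> 0" "e = Polynomial.smult s e'" "primitive e'"
      using primitive_part_ex[OF e(1)] by blast
    have "dvd_in A s a \<and> dvd_in (polys_over A) e' f'"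
      using e(2) unfolding s(3) a(3) dvd_in_smult_iff[OF s(4,1) a(4,1,2)] .
    moreover have "dvd_in A s b \<and> dvd_in (polys_over A) e' g'"
      using e(3) unfolding s(3) b(3) dvd_in_smult_iff[OF s(4,1) b(4,1,2)] .
    moreover have "e' \<in> polys_over A" using s by (simp add: primitive_def)
    ultimately have "dvd_in A s c \<and> dvd_in (polys_over A) e' h"
      using c h s(1) unfolding gcd_in_def by blast
    then show ?thesis unfolding s(3) dvd_in_smult_iff[OF s(4,1) hp c'] .
  qed
  moreover have "dvd_in (polys_over A) (Polynomial.smult c h) f" "dvd_in (polys_over A) (Polynomial.smult c h) g"
    unfolding a(3) b(3) dvd_in_smult_iff[OF hp c'(1) a(4,1,2)] dvd_in_smult_iff[OF hp c'(1) b(4,1,2)]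
    using c h unfolding gcd_in_def by blast+
  ultimately have "gcd_in (polys_over A) f g (Polynomial.smult c h)"
    using hp c' by (auto simp: gcd_in_def primitive_def polys_over_smult)
  then show ?thesis ..
qed

theorem gcd_subring_polys: "gcd_subring (polys_over A)"
  by unfold_locales (auto intro: polys_over_intros gcd_polys_ex)

end

section \<open>Multivariate polynomials\<close>

text \<open>The polynomial ring in the variables from \<open>S\<close>. Varying \<open>S\<close>
  inside a fixed type allows an induction on the number of variables.\<close>

definition mpolys_in :: "'v set \<Rightarrow> ('v::linorder, 'k::field) mpolynomial set" where
  "mpolys_in S = {p. \<forall>m\<in>Poly_Mapping.keys p. Poly_Mapping.keys m \<subseteq> S}"

abbreviation mvar :: "'v::linorder \<Rightarrow> ('v, 'k::field) mpolynomial" where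
  "mvar x \<equiv> Poly_Mapping.single (Poly_Mapping.single x (Suc 0)) 1"

lemma sum_monomials:
  "(\<Sum>m\<in>Poly_Mapping.keys p. Poly_Mapping.single m (Poly_Mapping.lookup p m)) = p"
  by (rule poly_mapping_eqI) (simp add: lookup_sum lookup_single when_def in_keys_iff)

lemma ring_subset_mpolys_in: "ring_subset (mpolys_in S)"
proof
  show "a + b \<in> mpolys_in S" if "a \<in> mpolys_in S" "b \<in> mpolys_in S" for a b :: "('a, 'b) mpolynomial"
    using that keys_add[of a b] unfolding mpolys_in_def by blast
  show "a - b \<in> mpolys_in S" if "a \<in> mpolys_in S" "b \<in> mpolys_in S" for a b :: "('a, 'b) mpolynomial"
  proof -
    have "Poly_Mapping.keys (a - b) \<subseteq> Poly_Mapping.keys a \<union> Poly_Mapping.keys b"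
      by (auto simp: in_keys_iff lookup_minus)
    then show ?thesis using that unfolding mpolys_in_def by blast
  qed
  show "a * b \<in> mpolys_in S" if "a \<in> mpolys_in S" "b \<in> mpolys_in S" for a b :: "('a, 'b) mpolynomial"
  proof -
    have "Poly_Mapping.keys (m + n) \<subseteq> S"
      if "Poly_Mapping.keys m \<subseteq> S" "Poly_Mapping.keys n \<subseteq> S" for m n :: "'a \<Rightarrow>\<^sub>0 nat"
      using that keys_add[of m n] by blast
    then show ?thesis using that keys_mult[of a b] unfolding mpolys_in_def by blast
  qed
qed (auto simp: mpolys_in_def)

lemma mvar_power: "(mvar x :: ('v::linorder, 'k::field) mpolynomial) ^ n = Poly_Mapping.single (Poly_Mapping.single x n) 1"
  by (induction n) (simp_all add: mult_single single_add[symmetric])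

text \<open>Since \<open>x\<close> does not occur in \<open>p\<close>, every monomial of the product
  has exponent exactly \<open>j\<close> in \<open>x\<close>, so contributions of different powers
  never mix.\<close>

lemma lookup_times_mvar_power:
  fixes p :: "('v::linorder, 'k::field) mpolynomial"
  assumes p: "p \<in> mpolys_in S" and x: "x \<notin> S" and m: "Poly_Mapping.keys m \<subseteq> S"
  shows "Poly_Mapping.lookup (p * mvar x ^ j) (m + Poly_Mapping.single x i) =
    (if i = j then Poly_Mapping.lookup p m else 0)"
proof -
  let ?X = "Poly_Mapping.single x"
  have lin: "Poly_Mapping.lookup (p * mvar x ^ j) k = (\<Sum>l\<in>Poly_Mapping.keys p. Poly_Mapping.lookup p l when l + ?X j = k)" for k
  proof -
    have "p * mvar x ^ j = (\<Sum>l\<in>Poly_Mapping.keys p. Poly_Mapping.single l (Poly_Mapping.lookup p l)) * mvar x ^ j"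
      by (simp add: sum_monomials)
    also have "\<dots> = (\<Sum>l\<in>Poly_Mapping.keys p. Poly_Mapping.single (l + ?X j) (Poly_Mapping.lookup p l))"
      by (simp add: sum_distrib_right mvar_power mult_single)
    finally show ?thesis by (simp add: lookup_sum lookup_single when_def)
  qed
  have off: "Poly_Mapping.lookup l x = 0" if "l \<in> Poly_Mapping.keys p" for l
    using that p x unfolding mpolys_in_def by (auto simp flip: not_in_keys_iff_lookup_eq_zero)
  have mx: "Poly_Mapping.lookup m x = 0" using m x by (auto simp: in_keys_iff)
  show ?thesis
  proof (cases "i = j")
    case True
    then show ?thesis unfolding lin
      by (simp add: when_def in_keys_iff)
  next
    case False
    have "l + ?X j \<noteq> m + ?X i" if "l \<in> Poly_Mapping.keys p" for l
    proof
      assume "l + ?X j = m + ?X i"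
      then have "Poly_Mapping.lookup (l + ?X j) x = Poly_Mapping.lookup (m + ?X i) x" by simp
      then show False using off[OF that] mx False by (simp add: lookup_add)
    qed
    then show ?thesis using False unfolding lin by (simp add: when_def)
  qed
qed

text \<open>The variable \<open>x\<close> is transcendental over the ring in the variables
  \<open>S\<close>: the coefficient of \<open>m x^i\<close> in the value of \<open>p\<close> is the
  coefficient of \<open>m\<close> in \<open>coeff p i\<close>.\<close>

lemma poly_mvar_inj:
  fixes p :: "('v::linorder, 'k::field) mpolynomial poly"
  assumes p: "p \<in> polys_over (mpolys_in S)" and x: "x \<notin> S" and z: "poly p (mvar x) = 0"
  shows "p = 0"
proof (rule poly_eqI)
  fix i
  have A: "coeff p j \<in> mpolys_in S" for j using p by (simp add: polys_over_def)
  show "coeff p i = coeff 0 i"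
  proof (cases "i \<le> degree p")
    case True
    have "Poly_Mapping.lookup (coeff p i) m = 0" for m
    proof (cases "Poly_Mapping.keys m \<subseteq> S")
      case m: True
      have "0 = Poly_Mapping.lookup (poly p (mvar x)) (m + Poly_Mapping.single x i)" using z by simp
      also have "\<dots> = (\<Sum>j\<le>degree p. if i = j then Poly_Mapping.lookup (coeff p j) m else 0)"
        unfolding poly_altdef lookup_sum lookup_times_mvar_power[OF A x m] ..
      also have "\<dots> = Poly_Mapping.lookup (coeff p i) m" using True by simp
      finally show ?thesis by simp
    next
      case False
      then show ?thesis using A[of i] unfolding mpolys_in_def by (auto simp: in_keys_iff)
    qed
    then show ?thesis by (simp add: poly_mapping_eqI)
  qed (simp add: coeff_eq_0)
qed

text \<open>With \<open>poly_mvar_inj\<close> this makes the ring in one more variable an isomorphic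
  copy of a univariate polynomial ring, to which the gcd construction applies.\<close>

lemma mpolys_in_insert:
  assumes x: "x \<notin> S"
  shows "(mpolys_in (insert x S) :: ('v::linorder, 'k::field) mpolynomial set) =
    (\<lambda>p. poly p (mvar x)) ` polys_over (mpolys_in S)"
    (is "?L = ?R")
proof
  interpret B: ring_subset "mpolys_in (insert x S) :: ('v, 'k) mpolynomial set" by (rule ring_subset_mpolys_in)
  interpret A: ring_subset "mpolys_in S :: ('v, 'k) mpolynomial set" by (rule ring_subset_mpolys_in)
  show "?R \<subseteq> ?L"
  proof (rule image_subsetI)
    fix p :: "('v, 'k) mpolynomial poly" assume p: "p \<in> polys_over (mpolys_in S)"
    have "mpolys_in S \<subseteq> ?L" unfolding mpolys_in_def by (intro Collect_mono) (meson order_trans subset_insertI)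
    moreover have "coeff p i \<in> mpolys_in S" for i
      using p by (simp add: polys_over_def)
    ultimately have "coeff p i \<in> ?L" for i by blast
    moreover have "(mvar x :: ('v, 'k) mpolynomial) ^ i \<in> ?L" for i
      unfolding mvar_power by (simp add: mpolys_in_def)
    ultimately show "poly p (mvar x) \<in> ?L"
      unfolding poly_altdef by (intro B.sum_mem B.mult_mem)
  qed
  show "?L \<subseteq> ?R"
  proof
    fix p :: "('v, 'k) mpolynomial" assume p: "p \<in> ?L"
    have mono: "Poly_Mapping.single m c \<in> ?R" if "Poly_Mapping.keys m \<subseteq> insert x S" for m and c :: 'k
    proof (rule image_eqI)
      \<comment> \<open>\<open>m'\<close> is the monomial \<open>m\<close> stripped of its power of
        \<open>x\<close>.\<close>
      define m' where "m' = m - Poly_Mapping.single x (Poly_Mapping.lookup m x)"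
      have m: "m = m' + Poly_Mapping.single x (Poly_Mapping.lookup m x)"
        by (rule poly_mapping_eqI) (simp add: m'_def lookup_add lookup_minus lookup_single when_def)
      have "Poly_Mapping.keys m' \<subseteq> S"
        using that x by (auto simp: m'_def subset_iff in_keys_iff lookup_minus lookup_single when_def split: if_splits)
      then have "Poly_Mapping.single m' c \<in> mpolys_in S" by (simp add: mpolys_in_def)
      then show "monom (Poly_Mapping.single m' c) (Poly_Mapping.lookup m x) \<in> polys_over (mpolys_in S)"
        by (rule A.polys_over_monom)
      show "Poly_Mapping.single m c = poly (monom (Poly_Mapping.single m' c) (Poly_Mapping.lookup m x)) (mvar x)"
        unfolding poly_monom mvar_power mult_single m[symmetric] by simp
    qed
    have add: "a + b \<in> ?R" if ab: "a \<in> ?R" "b \<in> ?R" for a b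
    proof -
      from ab obtain f g where "a = poly f (mvar x)" "b = poly g (mvar x)"
        "f \<in> polys_over (mpolys_in S)" "g \<in> polys_over (mpolys_in S)" by blast
      then have "a + b = poly (f + g) (mvar x)" "f + g \<in> polys_over (mpolys_in S)"
        by (simp_all add: A.polys_over_add)
      then show ?thesis by (rule image_eqI)
    qed
    have zero: "0 \<in> ?R" using mono[of 0 0] unfolding single_zero by simp
    have "(\<Sum>m\<in>M. Poly_Mapping.single m (Poly_Mapping.lookup p m)) \<in> ?R"
      if "finite M" "M \<subseteq> Poly_Mapping.keys p" for M
      using that
    proof (induction M rule: finite_induct)
      case empty
      show ?case unfolding sum.empty by (rule zero)
    next
      case (insert m M)
      then have "Poly_Mapping.single m (Poly_Mapping.lookup p m) \<in> ?R"
        using p by (intro mono) (simp add: mpolys_in_def)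
      moreover have "(\<Sum>m\<in>M. Poly_Mapping.single m (Poly_Mapping.lookup p m)) \<in> ?R"
        by (rule insert(3)) (use insert in simp)
      ultimately show ?case unfolding sum.insert[OF insert(1,2)] by (rule add)
    qed
    from this[OF finite_keys order_refl] have "(\<Sum>m\<in>Poly_Mapping.keys p. Poly_Mapping.single m (Poly_Mapping.lookup p m)) \<in> ?R" .
    then show "p \<in> ?R" unfolding sum_monomials .
  qed
qed

text \<open>An injective homomorphism preserves and reflects divisibility, so it transports gcds.
  Injectivity is asked on \<open>A\<close> alone, since evaluation at a variable is injective only
  when the coefficients avoid that variable.\<close>

lemma gcd_subring_image:
  fixes A :: "'a::idom set" and h :: "'a \<Rightarrow> 'b::idom"
  assumes A: "gcd_subring A"
    and h: "h 0 = 0" "h 1 = 1" "\<And>a b. h (a + b) = h a + h b" "\<And>a b. h (a - b) = h a - h b"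
      "\<And>a b. h (a * b) = h a * h b"
    and inj: "\<And>a. a \<in> A \<Longrightarrow> h a = 0 \<Longrightarrow> a = 0"
  shows "gcd_subring (h ` A)"
proof -
  interpret gcd_subring A by (rule A)
  have inj': "inj_on h A"
    using inj diff_mem h(4) by (intro inj_onI) (metis eq_iff_diff_eq_0)
  have dvd: "dvd_in (h ` A) (h a) (h b) \<longleftrightarrow> dvd_in A a b" if "a \<in> A" "b \<in> A" for a b
  proof
    assume "dvd_in (h ` A) (h a) (h b)"
    then obtain q where q: "q \<in> A" "h b = h (a * q)" unfolding dvd_in_def by (auto simp: h(5))
    then have "b = a * q" using inj' that mult_mem by (blast dest: inj_onD)
    then show "dvd_in A a b" using q unfolding dvd_in_def by blast
  qed (auto simp: dvd_in_def h(5))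
  show ?thesis
  proof
    show "0 \<in> h ` A" using h(1) zero_mem by (metis image_eqI)
    show "1 \<in> h ` A" using h(2) one_mem by (metis image_eqI)
    show "a + b \<in> h ` A" if "a \<in> h ` A" "b \<in> h ` A" for a b
      using that add_mem unfolding image_iff by (metis h(3))
    show "a - b \<in> h ` A" if "a \<in> h ` A" "b \<in> h ` A" for a b
      using that diff_mem unfolding image_iff by (metis h(4))
    show "a * b \<in> h ` A" if "a \<in> h ` A" "b \<in> h ` A" for a b
      using that mult_mem unfolding image_iff by (metis h(5))
    show "\<exists>d. gcd_in (h ` A) a b d" if ab: "a \<in> h ` A" "b \<in> h ` A" for a b
    proof -
      obtain a' b' where a': "a' \<in> A" "b' \<in> A" "a = h a'" "b = h b'" using ab by blast
      obtain d where "gcd_in A a' b' d" using gcd_ex a' by blast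
      then have "gcd_in (h ` A) a b (h d)" using a' unfolding gcd_in_def by (auto simp: dvd)
      then show ?thesis ..
    qed
  qed
qed

lemma mpolys_in_empty: "p \<in> mpolys_in {} \<longleftrightarrow> is_constant p"
proof
  assume "p \<in> mpolys_in {}"
  then have "Poly_Mapping.lookup p m = 0" if "m \<noteq> 0" for m
    using that unfolding mpolys_in_def by (auto simp: in_keys_iff)
  then have "p = Poly_Mapping.single 0 (Poly_Mapping.lookup p 0)"
    by (intro poly_mapping_eqI) (auto simp: lookup_single when_def)
  then show "is_constant p" unfolding is_constant_def by blast
qed (auto simp: is_constant_def mpolys_in_def split: if_splits)

lemma constant_dvd_one: "is_constant p \<Longrightarrow> p \<noteq> 0 \<Longrightarrow> \<exists>q\<in>mpolys_in {}. 1 = p * q"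
proof -
  assume "is_constant p" "p \<noteq> 0"
  then obtain c where c: "p = Poly_Mapping.single 0 c" unfolding is_constant_def by blast
  with \<open>p \<noteq> 0\<close> have "c \<noteq> 0" by auto
  with c show ?thesis
    by (intro bexI[of _ "Poly_Mapping.single 0 (inverse c)"])
       (simp_all add: mult_single mpolys_in_def)
qed

text \<open>Induction on the number of variables, starting from the field of constants. The fact
  that units are constants is carried along: a unit of a polynomial ring over a domain is a constant
  polynomial with a unit as coefficient.\<close>

lemma gcd_subring_mpolys_in:
  assumes "finite S"
  shows "gcd_subring (mpolys_in S :: ('v::linorder, 'k::field) mpolynomial set) \<and>
    (\<forall>p\<in>mpolys_in S. \<forall>q\<in>mpolys_in S. p * q = (1 :: ('v, 'k) mpolynomial) \<longrightarrow> is_constant p)"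
  using assms
proof (induction S rule: finite_induct)
  case empty
  interpret ring_subset "mpolys_in {} :: ('v, 'k) mpolynomial set" by (rule ring_subset_mpolys_in)
  have "\<exists>d. gcd_in (mpolys_in {}) a b d" if ab: "a \<in> mpolys_in {}" "b \<in> mpolys_in {}"
    for a b :: "('v, 'k) mpolynomial"
  proof (cases "a = 0")
    case True
    then have "gcd_in (mpolys_in {}) a b b" using ab by (simp add: gcd_in_def)
    then show ?thesis ..
  next
    case False
    then have "dvd_in (mpolys_in {}) a 1"
      using ab(1) constant_dvd_one unfolding mpolys_in_empty dvd_in_def by blast
    then have "dvd_in (mpolys_in {}) a b" using dvd_in_mult[of a 1 b] ab by simp
    then have "gcd_in (mpolys_in {}) a b a" using ab by (simp add: gcd_in_def)
    then show ?thesis ..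
  qed
  then show ?case by (auto simp: mpolys_in_empty intro!: gcd_subring.intro ring_subset_mpolys_in gcd_subring_axioms.intro)
next
  case (insert x S)
  let ?P = "polys_over (mpolys_in S) :: ('v, 'k) mpolynomial poly set"
  interpret A: gcd_subring "mpolys_in S :: ('v, 'k) mpolynomial set" using insert by blast
  have inj: "p = 0" if "p \<in> ?P" "poly p (mvar x) = 0" for p
    using poly_mvar_inj that insert by blast
  have "gcd_subring (mpolys_in (insert x S) :: ('v, 'k) mpolynomial set)"
    unfolding mpolys_in_insert[OF insert(2)]
    by (rule gcd_subring_image[OF A.gcd_subring_polys]) (auto intro: inj)
  moreover have "is_constant p"
    if pq: "p \<in> mpolys_in (insert x S)" "q \<in> mpolys_in (insert x S)" "p * q = 1"
    for p q :: "('v, 'k) mpolynomial"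
  proof -
    obtain f g where fg: "f \<in> ?P" "g \<in> ?P" "p = poly f (mvar x)" "q = poly g (mvar x)"
      using pq unfolding mpolys_in_insert[OF insert(2)] by blast
    \<comment> \<open>Evaluation at \<open>x\<close> sends this polynomial to
      \<open>p * q - 1 = 0\<close>, so injectivity lifts the equation to univariate
      polynomials.\<close>
    have "f * g - 1 = 0"
      by (rule inj) (use fg pq in \<open>auto intro: A.polys_over_intros\<close>)
    then have 1: "f * g = 1" by simp
    then have "f dvd 1" "g dvd 1" by (metis dvd_triv_left, metis dvd_triv_right)
    then obtain a b where ab: "f = [:a:]" "g = [:b:]" unfolding is_unit_poly_iff by blast
    then have "a * b = 1" using 1 by (simp add: one_pCons mult.commute)
    moreover have "a \<in> mpolys_in S" "b \<in> mpolys_in S"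
      using fg ab A.pCons_in_polys_over by auto
    ultimately have "is_constant a" using insert by blast
    then show ?thesis using fg ab by simp
  qed
  ultimately show ?case by blast
qed

lemma mpolys_in_UNIV: "mpolys_in UNIV = UNIV"
  by (simp add: mpolys_in_def)

text \<open>All that the matrix arguments take from \<open>k[z]\<close>: an integral domain with
  gcds of pairs.\<close>

locale gcd_dom =
  fixes ty :: "'a::idom itself"
  assumes gcd_pair_ex: "\<exists>d. is_gcd_of {a, b :: 'a} d"

lemma dvd_in_UNIV: "dvd_in UNIV a b \<longleftrightarrow> a dvd b"
  by (auto simp: dvd_in_def dvd_def)

lemma gcd_dom_mpolynomial: "gcd_dom TYPE(('v::{finite,linorder}, 'k::field) mpolynomial)"
proof -
  interpret gcd_subring "UNIV :: ('v, 'k) mpolynomial set"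
    using gcd_subring_mpolys_in[OF finite[of "UNIV :: 'v set"], where ?'k = 'k]
    unfolding mpolys_in_UNIV by (rule conjunct1)
  show ?thesis
  proof
    fix a b :: "('v, 'k) mpolynomial"
    obtain d where "gcd_in UNIV a b d" using gcd_ex by blast
    then have "is_gcd_of {a, b} d" by (simp add: is_gcd_of_def gcd_in_def dvd_in_UNIV)
    then show "\<exists>d. is_gcd_of {a, b} d" ..
  qed
qed

text \<open>Translates the condition in \<open>minor_left_prime\<close> into divisibility of 1, the
  form available in every gcd domain.\<close>

lemma is_constant_iff_unit:
  fixes p :: "('v::{finite,linorder}, 'k::field) mpolynomial"
  shows "p \<noteq> 0 \<and> is_constant p \<longleftrightarrow> p dvd 1"
proof
  assume "p \<noteq> 0 \<and> is_constant p"
  then show "p dvd 1" using constant_dvd_one unfolding dvd_def by blast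
next
  assume "p dvd 1"
  then obtain q where "1 = p * q" by (rule dvdE)
  then have q: "p * q = 1" by (rule sym)
  moreover have "\<forall>p\<in>UNIV. \<forall>q\<in>UNIV. p * q = (1 :: ('v, 'k) mpolynomial) \<longrightarrow> is_constant p"
    using gcd_subring_mpolys_in[OF finite[of "UNIV :: 'v set"], where ?'k = 'k]
    unfolding mpolys_in_UNIV by (rule conjunct2)
  ultimately have "is_constant p" by blast
  moreover have "p \<noteq> 0" using q by (metis mult_zero_left zero_neq_one)
  ultimately show "p \<noteq> 0 \<and> is_constant p" by blast
qed

section \<open>Maximal minors\<close>

context gcd_dom begin

lemma finite_gcd_ex:
  fixes S :: "'a set"
  assumes "finite S"
  shows "\<exists>d. is_gcd_of S d"
  using assms
proof (induction S rule: finite_induct)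
  case empty
  show ?case by (rule exI[of _ 0]) (simp add: is_gcd_of_def)
next
  case (insert x S)
  then obtain c where c: "is_gcd_of S c" by blast
  obtain d where d: "is_gcd_of {x, c} d" using gcd_pair_ex by blast
  have "is_gcd_of (insert x S) d"
    unfolding is_gcd_of_def
  proof (intro conjI ballI allI impI)
    fix s assume "s \<in> insert x S"
    then show "d dvd s"
      using c d dvd_trans[of d c s] unfolding is_gcd_of_def by auto
  next
    fix e assume e: "\<forall>s\<in>insert x S. e dvd s"
    then have "e dvd c" using c unfolding is_gcd_of_def by simp
    then show "e dvd d" using d e unfolding is_gcd_of_def by simp
  qed
  then show ?case ..
qed

text \<open>As for pairs, a gcd of the scaled set is \<open>c * t\<close> with \<open>t\<close>
  dividing \<open>d\<close>. This passes from a divisibility known for each maximal minor to one for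
  their gcd.\<close>

lemma dvd_scaled_gcd:
  fixes c d e :: 'a
  assumes S: "finite S" and d: "is_gcd_of S d" and e: "\<And>s. s \<in> S \<Longrightarrow> e dvd c * s"
  shows "e dvd c * d"
proof (cases "c = 0")
  case False
  obtain h where h: "is_gcd_of ((*) c ` S) h" using finite_gcd_ex S by blast
  have "c dvd h" using h unfolding is_gcd_of_def by auto
  then obtain t where t: "h = c * t" by (rule dvdE)
  have "t dvd s" if "s \<in> S" for s
    using h that False unfolding is_gcd_of_def t by auto
  then have "t dvd d" using d unfolding is_gcd_of_def by blast
  then have "h dvd c * d" unfolding t by simp
  moreover have "e dvd h" using h e unfolding is_gcd_of_def by auto
  ultimately show ?thesis by (rule dvd_trans[rotated])
qed simp

text \<open>Otherwise the gcd \<open>g\<close> of \<open>e\<close> and \<open>s\<close> is a unit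
  and the exponent can be lowered: \<open>e\<close> divides \<open>s^n * e\<close> and
  \<open>s^n * s\<close>, hence \<open>s^n * g\<close>, hence \<open>s^n\<close>. At exponent 0 this
  makes \<open>e\<close> a unit.\<close>

lemma nonunit_common_divisor_power:
  fixes e s :: 'a
  assumes e: "\<not> e dvd 1" and k: "e dvd s ^ k"
  shows "\<exists>g. \<not> g dvd 1 \<and> g dvd e \<and> g dvd s"
proof (rule ccontr)
  assume neg: "\<not> ?thesis"
  obtain g where g: "is_gcd_of {e, s} g" using gcd_pair_ex by blast
  then have "g dvd 1" using neg unfolding is_gcd_of_def by auto
  have "e dvd s ^ j" if "j \<le> k" for j
    using that
  proof (induction j rule: inc_induct)
    case (step n)
    have "e dvd s ^ n * g"
      by (rule dvd_scaled_gcd[OF _ g]) (use step in \<open>auto simp: mult.commute\<close>)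
    also have "s ^ n * g dvd s ^ n * 1" using \<open>g dvd 1\<close> by (intro mult_dvd_mono) auto
    finally show ?case by simp
  qed (rule k)
  from this[of 0] e show False by simp
qed

text \<open>The elements of \<open>S\<close> are treated one at a time: the divisor \<open>g\<close>
  found so far divides \<open>e\<close>, hence the \<open>k\<close>-th power of the next element,
  and is replaced by a nonunit divisor of \<open>g\<close> that divides this element too.\<close>

lemma nonunit_common_divisor_powers:
  fixes e :: 'a
  assumes "finite S" "\<not> e dvd 1" "\<And>s. s \<in> S \<Longrightarrow> e dvd s ^ k"
  shows "\<exists>g. \<not> g dvd 1 \<and> g dvd e \<and> (\<forall>s\<in>S. g dvd s)"
  using assms
proof (induction S rule: finite_induct)
  case (insert x S)
  then obtain g where g: "\<not> g dvd 1" "g dvd e" "\<forall>s\<in>S. g dvd s" by auto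
  then have "g dvd x ^ k" using dvd_trans[of g e "x ^ k"] insert.prems by simp
  then obtain h where "\<not> h dvd 1" "h dvd g" "h dvd x"
    using nonunit_common_divisor_power g by blast
  moreover from this g have "h dvd e" "\<forall>s\<in>S. h dvd s" using dvd_trans by blast+
  ultimately show ?case by blast
qed auto

end

text \<open>Columns are chosen by a function and not by a set, so they may be permuted or repeated:
  Cramer's rule changes one index, \<open>s(i := j)\<close>, and can cause both.\<close>

definition select_cols :: "'a mat \<Rightarrow> (nat \<Rightarrow> nat) \<Rightarrow> 'a mat" where
  "select_cols A s = mat (dim_row A) (dim_row A) (\<lambda>(i, j). A $$ (i, s j))"

lemma select_cols_carrier [simp]: "A \<in> carrier_mat r m \<Longrightarrow> select_cols A s \<in> carrier_mat r r"
  by (simp add: select_cols_def)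

lemma pick_lessThan: "i < n \<Longrightarrow> pick {..<n} i = i"
proof -
  assume i: "i < n"
  then have "{a \<in> {..<n}. a < i} = {..<i}" by auto
  then show ?thesis using pick_card_in_set[of i "{..<n}"] i by simp
qed

lemma submatrix_eq_select_cols:
  assumes A: "A \<in> carrier_mat r m" and I: "I \<subseteq> {..<r}" "card I = r"
    and J: "J \<subseteq> {..<m}" "card J = r"
  shows "submatrix A I J = select_cols A (pick J)"
proof -
  have "I = {..<r}" using I by (intro card_subset_eq) auto
  moreover have "{i. i < r \<and> i \<in> {..<r}} = {..<r}" "{j. j < m \<and> j \<in> J} = J" using J by auto
  ultimately show ?thesis using A J
    by (intro eq_matI) (auto simp: submatrix_def select_cols_def pick_lessThan)
qed

lemma pick_less:
  assumes "J \<subseteq> {..<m}" "card J = r" "j < r"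
  shows "pick J j < m"
proof -
  have "{a. a < m \<and> a \<in> J} = J" using assms by auto
  then show ?thesis using pick_le[of j m J] assms by simp
qed

lemma minors_eq:
  assumes A: "A \<in> carrier_mat r m"
  shows "minors r A = {det (select_cols A (pick J)) | J. J \<subseteq> {..<m} \<and> card J = r}"
proof -
  have "x \<in> minors r A" if "J \<subseteq> {..<m}" "card J = r" "x = det (select_cols A (pick J))" for x J
  proof -
    have "x = det (submatrix A {..<r} J)"
      using that submatrix_eq_select_cols[OF A _ _ that(1,2), of "{..<r}"] by simp
    moreover have "{..<r} \<subseteq> {..<dim_row A}" "J \<subseteq> {..<dim_col A}" "card {..<r} = r"
      using A that by auto
    ultimately show ?thesis using that(2) unfolding minors_def by blast
  qed
  moreover have "\<exists>J. x = det (select_cols A (pick J)) \<and> J \<subseteq> {..<m} \<and> card J = r"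
    if "x \<in> minors r A" for x
  proof -
    from that obtain I J where "x = det (submatrix A I J)" "I \<subseteq> {..<r}" "J \<subseteq> {..<m}"
      "card I = r" "card J = r" using A unfolding minors_def by auto
    then show ?thesis using submatrix_eq_select_cols[OF A] by metis
  qed
  ultimately show ?thesis by blast
qed

lemma finite_minors: "finite (minors i A)"
proof -
  have "minors i A \<subseteq> (\<lambda>(I, J). det (submatrix A I J)) ` (Pow {..<dim_row A} \<times> Pow {..<dim_col A})"
    unfolding minors_def by auto
  then show ?thesis by (rule finite_subset) auto
qed

lemma minors_select_cols:
  assumes A: "A \<in> carrier_mat r m" and x: "x \<in> minors r A"
  obtains s where "\<And>j. j < r \<Longrightarrow> s j < m" "x = det (select_cols A s)"
  using x pick_less unfolding minors_eq[OF A] by blast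

text \<open>A selection with a repeated column has determinant \<open>0\<close>; any other one is a permuted
  minor.\<close>

lemma dvd_det_select_cols:
  fixes A :: "'a::comm_ring_1 mat"
  assumes A: "A \<in> carrier_mat r m" and s: "\<And>j. j < r \<Longrightarrow> s j < m"
    and e: "\<And>x. x \<in> minors r A \<Longrightarrow> e dvd x"
  shows "e dvd det (select_cols A s)"
proof (cases "inj_on s {..<r}")
  case False
  then obtain i j where ij: "i < r" "j < r" "i \<noteq> j" "s i = s j" unfolding inj_on_def by auto
  have "col (select_cols A s) i = col (select_cols A s) j"
    using ij A by (intro eq_vecI) (auto simp: select_cols_def)
  then have "det (select_cols A s) = 0"
    using det_identical_columns[of "select_cols A s" r i j] A ij by auto
  then show ?thesis by simp
next
  case True
  define J where "J = s ` {..<r}"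
  have J: "J \<subseteq> {..<m}" "card J = r" using s True by (auto simp: J_def card_image)
  \<comment> \<open>\<open>p i\<close> is the position of \<open>s i\<close> in the increasing
    enumeration of \<open>J\<close>, counted from 0; outside the index range it is the identity, as
    \<open>permutes\<close> demands.\<close>
  define p where "p i = (if i < r then card {a \<in> J. a < s i} else i)" for i
  have pick_p: "pick J (p i) = s i" if "i < r" for i
    using that pick_card_in_set[of "s i" J] by (simp add: p_def J_def)
  have p_less: "p i < r" if "i < r" for i
  proof -
    have "{a \<in> J. a < s i} \<subset> J" using that unfolding J_def by blast
    then have "card {a \<in> J. a < s i} < card J" by (intro psubset_card_mono) (auto simp: J_def)
    then show ?thesis using that J by (simp add: p_def)
  qed
  have inj_p: "inj_on p {0..<r}"
  proof (rule inj_onI)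
    fix i j assume ij: "i \<in> {0..<r}" "j \<in> {0..<r}" "p i = p j"
    then have "s i = s j" using pick_p[of i] pick_p[of j] by simp
    then show "i = j" using True ij by (auto dest: inj_onD)
  qed
  have p: "p permutes {0..<r}"
  proof (rule bij_imp_permutes)
    have "p ` {0..<r} \<subseteq> {0..<r}" using p_less by auto
    then show "bij_betw p {0..<r} {0..<r}"
      using inj_p by (simp add: bij_betw_def endo_inj_surj)
  qed (simp add: p_def)
  let ?B = "transpose_mat (select_cols A (pick J))"
  have B: "?B \<in> carrier_mat r r" using A by simp
  have "transpose_mat (select_cols A s) = mat r r (\<lambda>(i, j). ?B $$ (p i, j))"
    using A p_less pick_p by (intro eq_matI) (auto simp: select_cols_def)
  then have "det (transpose_mat (select_cols A s)) = signof p * det ?B"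
    using det_permute_rows[OF B p] by simp
  then have "det (select_cols A s) = signof p * det (select_cols A (pick J))"
    using A det_transpose[of "select_cols A s" r] det_transpose[of "select_cols A (pick J)" r] by simp
  moreover have "e dvd det (select_cols A (pick J))" using e J minors_eq[OF A] by blast
  ultimately show ?thesis by simp
qed

lemma select_cols_mult:
  assumes G: "G \<in> carrier_mat r r" and F: "F \<in> carrier_mat r m" and s: "\<And>j. j < r \<Longrightarrow> s j < m"
  shows "select_cols (G * F) s = G * select_cols F s"
  using assms by (intro eq_matI) (auto simp: select_cols_def scalar_prod_def)

lemma det_select_cols_mult:
  fixes G F :: "'a::comm_ring_1 mat"
  assumes "G \<in> carrier_mat r r" "F \<in> carrier_mat r m" "\<And>j. j < r \<Longrightarrow> s j < m"
  shows "det (select_cols (G * F) s) = det G * det (select_cols F s)"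
  using assms by (simp add: select_cols_mult det_mult[of _ r])

text \<open>Cramer's rule: expand the determinant along column \<open>i\<close>, the only column
  that was replaced; its cofactors are those of \<open>select_cols F s\<close>.\<close>

lemma adj_mat_mult_index:
  fixes F :: "'a::comm_ring_1 mat"
  assumes F: "F \<in> carrier_mat r m" and s: "\<And>j. j < r \<Longrightarrow> s j < m" and ij: "i < r" "j < m"
  shows "(adj_mat (select_cols F s) * F) $$ (i, j) = det (select_cols F (s(i := j)))"
proof -
  let ?A = "select_cols F s" and ?B = "select_cols F (s(i := j))"
  have "mat_delete ?B k i = mat_delete ?A k i" if "k < r" for k
    using F ij that by (intro eq_matI) (auto simp: mat_delete_def select_cols_def)
  then have "cofactor ?B k i = cofactor ?A k i" if "k < r" for k
    using that by (simp add: cofactor_def)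
  moreover have "det ?B = (\<Sum>k<r. ?B $$ (k, i) * cofactor ?B k i)"
    using F ij by (intro laplace_expansion_column) auto
  moreover have "?B $$ (k, i) = F $$ (k, j)" if "k < r" for k
    using F ij that by (simp add: select_cols_def)
  ultimately have "det ?B = (\<Sum>k<r. F $$ (k, j) * cofactor ?A k i)" by simp
  also have "\<dots> = (adj_mat ?A * F) $$ (i, j)"
    using F ij by (simp add: adj_mat_def select_cols_def scalar_prod_def lessThan_atLeast0 mult.commute)
  finally show ?thesis by simp
qed

section \<open>Row modules\<close>

lemma mult_mat_vec_transpose_index:
  assumes "A \<in> carrier_mat r m" "w \<in> carrier_vec r" "j < m"
  shows "(transpose_mat A *\<^sub>v w) $ j = (\<Sum>i<r. A $$ (i, j) * w $ i)"
  using assms by (auto simp: scalar_prod_def lessThan_atLeast0 intro!: sum.cong)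

text \<open>From here on a row combination with coefficients \<open>w\<close> is the transpose
  applied to \<open>w\<close>. Passing through the list of rows gives each row its own coefficient
  even when rows repeat.\<close>

lemma row_module_conv:
  fixes A :: "'a::idom mat"
  assumes A: "A \<in> carrier_mat r m"
  shows "row_module A = {transpose_mat A *\<^sub>v w | w. w \<in> carrier_vec r}"
proof -
  interpret idom_vec m "TYPE('a)" .
  have rows: "set (rows A) \<subseteq> carrier_vec m" using A by (auto simp: rows_def)
  have dims: "\<forall>w\<in>set (rows A). dim_vec w = m" using rows by auto
  have len: "length (rows A) = r" using A by simp
  have T: "mat_of_cols m (rows A) = transpose_mat A"
    using A transpose_mat_of_rows[of m "rows A"] by (metis carrier_matD(2) mat_of_rows_rows)
  have "lincomb_list c (rows A) = transpose_mat A *\<^sub>v vec r c" for c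
    using lincomb_list_as_mat_mult[of "rows A" c] dims len unfolding T by simp
  moreover have "row_module A = {lincomb_list c (rows A) | c. True}"
    using A span_list_as_span[OF rows] unfolding row_module_def span_list_def by auto
  moreover have "\<exists>c. w = vec r c" if "w \<in> carrier_vec r" for w :: "'a vec"
    using that by (intro exI[of _ "\<lambda>i. w $ i"]) auto
  ultimately show ?thesis by (force intro: vec_carrier)
qed

text \<open>A set of rows forgets repetitions; \<open>distinct\<close> lets coefficients indexed by
  rows correspond to coefficients indexed by row numbers.\<close>

lemma vec_lin_indpt_rows:
  fixes A :: "'a::idom mat"
  assumes A: "A \<in> carrier_mat r m" and d: "distinct (rows A)"
  shows "vec_lin_indpt m (set (rows A)) \<longleftrightarrow>
    (\<forall>w\<in>carrier_vec r. transpose_mat A *\<^sub>v w = 0\<^sub>v m \<longrightarrow> w = 0\<^sub>v r)"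
proof -
  interpret idom_vec m "TYPE('a)" .
  have rows: "set (rows A) \<subseteq> carrier_vec m" using A by (auto simp: rows_def)
  have dims: "\<forall>w\<in>set (rows A). dim_vec w = m" using rows by auto
  have len: "length (rows A) = r" using A by simp
  have T: "mat_of_cols m (rows A) = transpose_mat A"
    using A transpose_mat_of_rows[of m "rows A"] by (metis carrier_matD(2) mat_of_rows_rows)
  have lc: "lincomb c (set (rows A)) = transpose_mat A *\<^sub>v vec r (\<lambda>i. c (rows A ! i))" for c
    using lincomb_as_lincomb_list_distinct[OF rows d] lincomb_list_as_mat_mult[of "rows A"] dims len
    unfolding T by simp
  show ?thesis
  proof
    assume indpt: "\<not> lin_dep (set (rows A))"
    show "\<forall>w\<in>carrier_vec r. transpose_mat A *\<^sub>v w = 0\<^sub>v m \<longrightarrow> w = 0\<^sub>v r"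
    proof (intro ballI impI)
      fix w :: "'a vec" assume w: "w \<in> carrier_vec r" "transpose_mat A *\<^sub>v w = 0\<^sub>v m"
      define c where "c v = w $ (SOME i. i < r \<and> rows A ! i = v)" for v
      have c: "c (rows A ! i) = w $ i" if "i < r" for i
      proof -
        have "(SOME j. j < r \<and> rows A ! j = rows A ! i) = i"
          using that len nth_eq_iff_index_eq[OF d] by (intro some_equality) blast+
        then show ?thesis by (simp add: c_def)
      qed
      have "vec r (\<lambda>i. c (rows A ! i)) = w" using w c by (intro eq_vecI) auto
      then have "lincomb c (set (rows A)) = 0\<^sub>v m" using lc w by simp
      then have "c v = 0" if "v \<in> set (rows A)" for v
        using lin_dep_crit[where A = "set (rows A)" and S = "set (rows A)" and a = c and v = v] indpt that by auto
      then have "w $ i = 0" if "i < r" for i using c[OF that] that len nth_mem[of i "rows A"] by metis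
      then show "w = 0\<^sub>v r" using w by (intro eq_vecI) auto
    qed
  next
    assume inj: "\<forall>w\<in>carrier_vec r. transpose_mat A *\<^sub>v w = 0\<^sub>v m \<longrightarrow> w = 0\<^sub>v r"
    show "\<not> lin_dep (set (rows A))"
    proof
      assume "lin_dep (set (rows A))"
      then obtain c v where c: "lincomb c (set (rows A)) = 0\<^sub>v m" "v \<in> set (rows A)" "c v \<noteq> 0"
        using finite_lin_dep[of "set (rows A)"] rows by auto
      then have "vec r (\<lambda>i. c (rows A ! i)) = 0\<^sub>v r" using inj lc by auto
      moreover obtain i where "i < r" "v = rows A ! i" using c(2) len by (metis in_set_conv_nth)
      ultimately show False using c(3) by (metis index_vec index_zero_vec(1))
    qed
  qed
qed

lemma free_of_rank_iff:
  fixes K :: "'a::idom vec set"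
  shows "free_of_rank m K r \<longleftrightarrow> (\<exists>A\<in>carrier_mat r m. row_module A = K \<and>
    (\<forall>w\<in>carrier_vec r. transpose_mat A *\<^sub>v w = 0\<^sub>v m \<longrightarrow> w = 0\<^sub>v r))"
proof
  assume "free_of_rank m K r"
  then obtain B where B: "B \<subseteq> carrier_vec m" "finite B" "card B = r" "vec_lin_indpt m B"
    "vec_span m B = K" unfolding free_of_rank_def by blast
  obtain bs where bs: "set bs = B" "distinct bs" using finite_distinct_list[OF B(2)] by blast
  define A where "A = mat_of_rows m bs"
  have A: "A \<in> carrier_mat r m" using bs B(3) distinct_card[OF bs(2)] by (simp add: A_def)
  have rows: "rows A = bs" unfolding A_def using bs B(1) by (intro rows_mat_of_rows) auto
  have "row_module A = K" using A rows bs B by (simp add: row_module_def)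
  moreover have "\<forall>w\<in>carrier_vec r. transpose_mat A *\<^sub>v w = 0\<^sub>v m \<longrightarrow> w = 0\<^sub>v r"
    using vec_lin_indpt_rows[OF A] rows bs B(4) by simp
  ultimately show "\<exists>A\<in>carrier_mat r m. row_module A = K \<and>
    (\<forall>w\<in>carrier_vec r. transpose_mat A *\<^sub>v w = 0\<^sub>v m \<longrightarrow> w = 0\<^sub>v r)" using A by blast
next
  assume "\<exists>A\<in>carrier_mat r m. row_module A = K \<and>
    (\<forall>w\<in>carrier_vec r. transpose_mat A *\<^sub>v w = 0\<^sub>v m \<longrightarrow> w = 0\<^sub>v r)"
  then obtain A where A: "A \<in> carrier_mat r m" and K: "row_module A = K"
    and inj: "\<And>w. w \<in> carrier_vec r \<Longrightarrow> transpose_mat A *\<^sub>v w = 0\<^sub>v m \<Longrightarrow> w = 0\<^sub>v r"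
    by blast
  have d: "distinct (rows A)" unfolding distinct_conv_nth
  proof (intro allI impI notI)
    fix i j assume ij: "i < length (rows A)" "j < length (rows A)" "i \<noteq> j" "rows A ! i = rows A ! j"
    \<comment> \<open>Two equal rows would give this nontrivial relation; hence the rows are
      distinct and their set has exactly \<open>r\<close> elements.\<close>
    let ?w = "unit_vec r i - unit_vec r j :: 'a vec"
    have w: "?w \<in> carrier_vec r" by simp
    have "row A i = row A j" using ij A by simp
    then have "A $$ (i, k) = A $$ (j, k)" if "k < m" for k
      using that A ij by (metis carrier_matD index_row(1) length_rows)
    then have "transpose_mat A *\<^sub>v ?w = 0\<^sub>v m"
      using A ij by (intro eq_vecI) (auto simp: scalar_prod_minus_distrib[of _ r])
    then have "?w = 0\<^sub>v r" using inj w by blast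
    then have "?w $ i = 0" using ij A by simp
    then show False using ij A by simp
  qed
  have "card (set (rows A)) = r" using A distinct_card[OF d] by simp
  moreover have "vec_lin_indpt m (set (rows A))" using vec_lin_indpt_rows[OF A d] inj by blast
  moreover have "vec_span m (set (rows A)) = K" using A K by (simp add: row_module_def)
  moreover have "set (rows A) \<subseteq> carrier_vec m" using A by (auto simp: rows_def)
  ultimately show "free_of_rank m K r" unfolding free_of_rank_def by blast
qed

section \<open>Rank over the fraction field\<close>

context vec_space begin

lemma det_nonzero_cols:
  assumes A: "A \<in> carrier_mat n n" and d: "det A \<noteq> 0"
  shows "distinct (cols A)" "lin_indpt (set (cols A))"
proof -
  have r: "rank A = n" using A d det_rank_iff by blast
  then show "distinct (cols A)" using non_distinct_low_rank[OF A] by auto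
  then show "lin_indpt (set (cols A))" using full_rank_lin_indpt A r by blast
qed

lemma rank_le_dim:
  assumes A: "A \<in> carrier_mat n m"
  shows "rank A \<le> n"
proof -
  obtain S where S: "finite S" "maximal S (\<lambda>T. T \<subseteq> set (cols A) \<and> lin_indpt T)"
    using maximal_exists_superset[of "set (cols A)" "\<lambda>T. T \<subseteq> set (cols A) \<and> lin_indpt T" "{}"]
      finite_lin_indpt2[of "{}"] by auto
  then have "S \<subseteq> carrier_vec n" "lin_indpt S"
    using A cols_dim[of A] unfolding maximal_def by auto
  then have "card S \<le> n" using li_le_dim(2)[of S] dim_is_n by simp
  then show ?thesis using rank_card_indpt[OF A S(2)] by simp
qed

text \<open>Forwards, a maximal independent set of columns has \<open>n\<close> elements and
  \<open>s\<close> lists their indices. Backwards, the columns of an invertible selection are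
  \<open>n\<close> independent columns of \<open>A\<close>.\<close>

lemma full_rank_iff_minor:
  assumes A: "A \<in> carrier_mat n m"
  shows "rank A = n \<longleftrightarrow> (\<exists>s. (\<forall>j<n. s j < m) \<and> det (select_cols A s) \<noteq> 0)"
proof
  assume r: "rank A = n"
  obtain S where S: "finite S" "maximal S (\<lambda>T. T \<subseteq> set (cols A) \<and> lin_indpt T)"
    using maximal_exists_superset[of "set (cols A)" "\<lambda>T. T \<subseteq> set (cols A) \<and> lin_indpt T" "{}"]
      finite_lin_indpt2[of "{}"] by auto
  have S': "S \<subseteq> set (cols A)" "lin_indpt S" "card S = n"
    using S(2) rank_card_indpt[OF A S(2)] r unfolding maximal_def by auto
  obtain vs where vs: "set vs = S" "distinct vs" using finite_distinct_list[OF S(1)] by blast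
  have len: "length vs = n" using vs S' distinct_card by fastforce
  have "\<exists>k<m. col A k = vs ! j" if "j < n" for j
  proof -
    have "vs ! j \<in> set (cols A)" using that len vs S' nth_mem by blast
    then show ?thesis using A unfolding in_set_conv_nth by auto
  qed
  then obtain s where s: "\<And>j. j < n \<Longrightarrow> s j < m \<and> col A (s j) = vs ! j" by metis
  let ?B = "select_cols A s"
  have B: "?B \<in> carrier_mat n n" using A by simp
  have "cols ?B = vs"
  proof (rule nth_equalityI)
    fix j assume "j < length (cols ?B)"
    then have j: "j < n" using B by simp
    have "col ?B j = col A (s j)"
      using A s[OF j, THEN conjunct1] j by (intro eq_vecI) (auto simp: select_cols_def)
    then show "cols ?B ! j = vs ! j" using B j s[OF j] by simp
  qed (use B len in simp)
  then have "rank ?B = n" using lin_indpt_full_rank[OF B] vs S' by simp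
  then have "det ?B \<noteq> 0" using det_rank_iff[OF B] by simp
  then show "\<exists>s. (\<forall>j<n. s j < m) \<and> det (select_cols A s) \<noteq> 0" using s by blast
next
  assume "\<exists>s. (\<forall>j<n. s j < m) \<and> det (select_cols A s) \<noteq> 0"
  then obtain s where s: "\<And>j. j < n \<Longrightarrow> s j < m" "det (select_cols A s) \<noteq> 0" by blast
  let ?B = "select_cols A s"
  have B: "?B \<in> carrier_mat n n" using A by simp
  note indpt = det_nonzero_cols[OF B s(2)]
  have "col ?B j = col A (s j)" if "j < n" for j
    using A s(1)[OF that] that by (intro eq_vecI) (auto simp: select_cols_def)
  then have "set (cols ?B) \<subseteq> set (cols A)"
    using A B s(1) by (auto simp: cols_def select_cols_def)
  then have "card (set (cols ?B)) \<le> rank A" using rank_ge_card_indpt[OF A] indpt by blast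
  then show "rank A = n" using rank_le_dim[OF A] distinct_card[OF indpt(1)] B by simp
qed

end

text \<open>The nonzero minor on rows \<open>p\<close> and columns \<open>s\<close> makes the
  columns \<open>s\<close> independent, and as \<open>r\<close> is the rank they span all columns.
  The coefficients \<open>c\<close> are the same for every row.\<close>

lemma rows_determine_columns:
  fixes A :: "'a::field mat"
  assumes A: "A \<in> carrier_mat l m" and rank: "vec_space.rank l A = r"
    and p: "\<And>t. t < r \<Longrightarrow> p t < l" and s: "\<And>k. k < r \<Longrightarrow> s k < m"
    and det: "det (mat r r (\<lambda>(t, k). A $$ (p t, s k))) \<noteq> 0" and j: "j < m"
  shows "\<exists>c. \<forall>i<l. A $$ (i, j) = (\<Sum>k<r. A $$ (i, s k) * c k)"
proof -
  interpret vec_space "TYPE('a)" l .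
  let ?M = "mat r r (\<lambda>(t, k). A $$ (p t, s k))"
  let ?B = "mat l r (\<lambda>(i, k). A $$ (i, s k))"
  have B: "?B \<in> carrier_mat l r" by simp
  \<comment> \<open>A relation between the columns \<open>s\<close> restricts to the rows
    \<open>p\<close>, where the invertible \<open>?M\<close> makes it trivial.\<close>
  have inj: "v = 0\<^sub>v r" if v: "v \<in> carrier_vec r" "?B *\<^sub>v v = 0\<^sub>v l" for v
  proof -
    have "(?M *\<^sub>v v) $ t = 0" if t: "t < r" for t
    proof -
      have "(?M *\<^sub>v v) $ t = (?B *\<^sub>v v) $ p t"
        using t p[OF t] v(1) by (simp add: scalar_prod_def)
      then show ?thesis using v(2) p[OF t] by simp
    qed
    then have "?M *\<^sub>v v = 0\<^sub>v r" by (intro eq_vecI) auto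
    then show ?thesis using det_0_iff_vec_prod_zero_field[of ?M r] det v(1) by auto
  qed
  have "distinct (cols ?B)" unfolding distinct_conv_nth
  proof (intro allI impI notI)
    fix a b assume ab: "a < length (cols ?B)" "b < length (cols ?B)" "a \<noteq> b" "cols ?B ! a = cols ?B ! b"
    then have "col ?M a = col ?M b"
    proof -
      have "A $$ (i, s a) = A $$ (i, s b)" if "i < l" for i
      proof -
        have "col ?B a $ i = col ?B b $ i" using ab by simp
        then show ?thesis using ab(1,2) that by simp
      qed
      then show ?thesis using ab p by (intro eq_vecI) auto
    qed
    then show False using det det_identical_columns[of ?M r a b] ab by auto
  qed
  moreover have "lin_indpt (set (cols ?B))"
    using lin_depE[OF B _ \<open>distinct (cols ?B)\<close>] inj by blast
  moreover have sub: "set (cols ?B) \<subseteq> set (cols A)"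
  proof -
    have "col ?B k = col A (s k)" if "k < r" for k
      using A s[OF that] that by (intro eq_vecI) auto
    then have "set (cols ?B) = (\<lambda>k. col A (s k)) ` {..<r}"
      by (auto simp: cols_def lessThan_atLeast0 image_iff)
    moreover have "set (cols A) = col A ` {..<m}" using A by (simp add: cols_def lessThan_atLeast0)
    ultimately show ?thesis using s by auto
  qed
  ultimately have B': "distinct (cols ?B)" "lin_indpt (set (cols ?B))" "set (cols ?B) \<subseteq> set (cols A)" .
  have carr: "set (cols ?B) \<subseteq> carrier_vec l" using cols_dim[of ?B] by simp
  have cj: "col A j \<in> carrier_vec l" "col A j \<in> set (cols A)" using A j by (simp_all add: cols_def)
  have "col A j \<in> span (set (cols ?B))"
  proof (cases "col A j \<in> set (cols ?B)")
    case True
    then show ?thesis by (rule span_mem[OF carr])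
  next
    case False
    \<comment> \<open>Otherwise \<open>A\<close> would have \<open>r + 1\<close> independent
      columns.\<close>
    have "lin_dep (set (cols ?B) \<union> {col A j})"
    proof (rule ccontr)
      assume indpt: "\<not> lin_dep (set (cols ?B) \<union> {col A j})"
      have "set (cols ?B) \<union> {col A j} \<subseteq> set (cols A)" using B'(3) cj(2) by simp
      then have "card (set (cols ?B) \<union> {col A j}) \<le> rank A"
        using rank_ge_card_indpt[OF A _ indpt] by blast
      moreover have "card (set (cols ?B) \<union> {col A j}) = Suc r"
        using False distinct_card[OF B'(1)] by simp
      ultimately show False using rank by simp
    qed
    then show ?thesis using lin_dep_iff_in_span[OF carr B'(2) cj(1) False] by blast
  qed
  then obtain a where a: "col A j = lincomb a (set (cols ?B))"
    using finite_span[of "set (cols ?B)"] carr by auto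
  then have eq: "col A j = ?B *\<^sub>v vec r (\<lambda>k. a (col ?B k))"
    using mat_mult_eq_lincomb[OF B B'(1)] by simp
  show ?thesis
  proof (intro exI[of _ "\<lambda>k. a (col ?B k)"] allI impI)
    fix i assume i: "i < l"
    have "A $$ (i, j) = col A j $ i" using A i j by simp
    also have "\<dots> = (?B *\<^sub>v vec r (\<lambda>k. a (col ?B k))) $ i" using eq by simp
    also have "\<dots> = (\<Sum>k<r. A $$ (i, s k) * a (col ?B k))"
      using i by (simp add: scalar_prod_def lessThan_atLeast0)
    finally show "A $$ (i, j) = (\<Sum>k<r. A $$ (i, s k) * a (col ?B k))" .
  qed
qed

interpretation to_fract: inj_comm_ring_hom "to_fract :: 'a::idom \<Rightarrow> 'a fract"
  by unfold_locales auto

lemma full_row_rank_iff_minor: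
  fixes A :: "'a::idom mat"
  assumes A: "A \<in> carrier_mat r m"
  shows "full_row_rank A \<longleftrightarrow> (\<exists>s. (\<forall>j<r. s j < m) \<and> det (select_cols A s) \<noteq> 0)"
proof -
  interpret vec_space "TYPE('a fract)" r .
  have "det (select_cols (map_mat to_fract A) s) = to_fract (det (select_cols A s))"
    if "\<forall>j<r. s j < m" for s
  proof -
    have "select_cols (map_mat to_fract A) s = map_mat to_fract (select_cols A s)"
      using A that by (intro eq_matI) (auto simp: select_cols_def)
    then show ?thesis by (simp add: to_fract.hom_det)
  qed
  then show ?thesis
    using full_rank_iff_minor[of "map_mat to_fract A" m] A
    unfolding full_row_rank_def fract_rank_def by auto
qed

text \<open>Over the fraction field, column \<open>j\<close> is a combination of the columns
  \<open>s\<close> with coefficients common to all rows, so a relation between rows that holds in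
  the columns \<open>s\<close> holds in column \<open>j\<close>.\<close>

lemma row_combination_extends:
  fixes F :: "'a::idom mat"
  assumes F: "F \<in> carrier_mat l m" and rank: "fract_rank F = r"
    and p: "\<And>t. t < r \<Longrightarrow> p t < l" and s: "\<And>k. k < r \<Longrightarrow> s k < m"
    and det: "det (mat r r (\<lambda>(t, k). F $$ (p t, s k))) \<noteq> 0"
    and i: "i < l" and j: "j < m"
    and w: "\<And>k. k < r \<Longrightarrow> d * F $$ (i, s k) = (\<Sum>t<r. w t * F $$ (p t, s k))"
  shows "d * F $$ (i, j) = (\<Sum>t<r. w t * F $$ (p t, j))"
proof -
  let ?F = "map_mat to_fract F"
  have idx: "?F $$ (a, b) = to_fract (F $$ (a, b))" if "a < l" "b < m" for a b
    using F that by simp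
  have "mat r r (\<lambda>(t, k). ?F $$ (p t, s k)) = map_mat to_fract (mat r r (\<lambda>(t, k). F $$ (p t, s k)))"
    using idx p s by (intro eq_matI) auto
  then have "det (mat r r (\<lambda>(t, k). ?F $$ (p t, s k))) \<noteq> 0"
    using det by (simp add: to_fract.hom_det)
  then obtain c where c: "\<And>i. i < l \<Longrightarrow> ?F $$ (i, j) = (\<Sum>k<r. ?F $$ (i, s k) * c k)"
    using rows_determine_columns[of ?F l m r p s j] F rank p s j by (auto simp: fract_rank_def)
  have c': "to_fract (F $$ (a, j)) = (\<Sum>k<r. to_fract (F $$ (a, s k)) * c k)" if "a < l" for a
    using c[OF that] idx[OF that] s j by simp
  have "to_fract (d * F $$ (i, j)) = to_fract d * (\<Sum>k<r. to_fract (F $$ (i, s k)) * c k)"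
    using c'[OF i] by simp
  also have "\<dots> = (\<Sum>k<r. to_fract (d * F $$ (i, s k)) * c k)"
    by (simp add: sum_distrib_left mult.assoc)
  also have "\<dots> = (\<Sum>k<r. (\<Sum>t<r. to_fract (w t) * to_fract (F $$ (p t, s k))) * c k)"
    using w by (intro sum.cong) (auto simp: to_fract.hom_sum)
  also have "\<dots> = (\<Sum>t<r. to_fract (w t) * (\<Sum>k<r. to_fract (F $$ (p t, s k)) * c k))"
    unfolding sum_distrib_left sum_distrib_right mult.assoc by (rule sum.swap)
  also have "\<dots> = (\<Sum>t<r. to_fract (w t) * to_fract (F $$ (p t, j)))"
    using c' p by simp
  also have "\<dots> = to_fract (\<Sum>t<r. w t * F $$ (p t, j))" by (simp add: to_fract.hom_sum)
  finally show ?thesis by (simp only: to_fract_eq_iff)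
qed

section \<open>Quotients of row modules\<close>

lemma mult_mat_vec_smult:
  fixes A :: "'a::comm_ring_1 mat"
  assumes "A \<in> carrier_mat nr nc" "v \<in> carrier_vec nc"
  shows "A *\<^sub>v (c \<cdot>\<^sub>v v) = c \<cdot>\<^sub>v (A *\<^sub>v v)"
  using assms by (intro eq_vecI) auto

lemma smult_one_mat_mult_vec:
  fixes w :: "'a::comm_ring_1 vec"
  assumes "w \<in> carrier_vec r"
  shows "(c \<cdot>\<^sub>m 1\<^sub>m r) *\<^sub>v w = c \<cdot>\<^sub>v w"
  using assms by (intro eq_vecI) auto

text \<open>Cramer's rule recovers \<open>w\<close>, up to a minor, from the coordinates
  \<open>s\<close> of its row combination: these are the transpose of \<open>select_cols F s\<close>
  applied to \<open>w\<close>, and the transposed adjugate turns that matrix into its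
  determinant.\<close>

lemma det_select_cols_smult_vec:
  fixes F :: "'a::comm_ring_1 mat"
  assumes F: "F \<in> carrier_mat r m" and s: "\<And>k. k < r \<Longrightarrow> s k < m" and w: "w \<in> carrier_vec r"
  shows "det (select_cols F s) \<cdot>\<^sub>v w =
    transpose_mat (adj_mat (select_cols F s)) *\<^sub>v vec r (\<lambda>k. (transpose_mat F *\<^sub>v w) $ s k)"
proof -
  let ?A = "select_cols F s"
  have A: "?A \<in> carrier_mat r r" using F by simp
  have adj: "adj_mat ?A \<in> carrier_mat r r" using adj_mat(1)[OF A] .
  have "vec r (\<lambda>k. (transpose_mat F *\<^sub>v w) $ s k) = transpose_mat ?A *\<^sub>v w"
    using F s w by (intro eq_vecI) (auto simp: select_cols_def scalar_prod_def)
  then have "transpose_mat (adj_mat ?A) *\<^sub>v vec r (\<lambda>k. (transpose_mat F *\<^sub>v w) $ s k)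
      = (transpose_mat (adj_mat ?A) * transpose_mat ?A) *\<^sub>v w"
    using A adj w by simp
  also have "transpose_mat (adj_mat ?A) * transpose_mat ?A = transpose_mat (?A * adj_mat ?A)"
    using transpose_mult[OF A adj] by simp
  also have "\<dots> = det ?A \<cdot>\<^sub>m 1\<^sub>m r"
    unfolding adj_mat(2)[OF A] by (rule eq_matI) auto
  also have "\<dots> *\<^sub>v w = det ?A \<cdot>\<^sub>v w" by (rule smult_one_mat_mult_vec[OF w])
  finally show ?thesis by simp
qed

lemma row_moduleI:
  fixes A :: "'a::idom mat"
  assumes "A \<in> carrier_mat r m" "w \<in> carrier_vec r"
  shows "transpose_mat A *\<^sub>v w \<in> row_module A"
  using assms row_module_conv by blast

lemma row_combination_eq_zero:
  fixes F :: "'a::idom mat"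
  assumes F: "F \<in> carrier_mat r m" and s: "\<And>k. k < r \<Longrightarrow> s k < m" and d: "det (select_cols F s) \<noteq> 0"
    and w: "w \<in> carrier_vec r" "transpose_mat F *\<^sub>v w = 0\<^sub>v m"
  shows "w = 0\<^sub>v r"
proof -
  have "vec r (\<lambda>k. (transpose_mat F *\<^sub>v w) $ s k) = 0\<^sub>v r"
    unfolding w(2) using s by (intro eq_vecI) auto
  moreover have "transpose_mat (adj_mat (select_cols F s)) *\<^sub>v 0\<^sub>v r = 0\<^sub>v r"
    using adj_mat(1)[of "select_cols F s" r] F by (intro eq_vecI) auto
  ultimately have "det (select_cols F s) \<cdot>\<^sub>v w = 0\<^sub>v r"
    using det_select_cols_smult_vec[OF F s w(1)] by simp
  then have "det (select_cols F s) * w $ i = 0" if "i < r" for i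
    using that w(1) by (metis carrier_vecD index_smult_vec(1) index_zero_vec(1))
  then show ?thesis using d w(1) by (intro eq_vecI) auto
qed

lemma vec_dvd_factor:
  fixes w :: "'a::comm_ring_1 vec"
  assumes "w \<in> carrier_vec r" "\<And>i. i < r \<Longrightarrow> c dvd w $ i"
  obtains v where "v \<in> carrier_vec r" "w = c \<cdot>\<^sub>v v"
proof -
  have "\<forall>i. \<exists>q. i < r \<longrightarrow> w $ i = c * q" using assms(2) unfolding dvd_def by blast
  then obtain q where q: "\<And>i. i < r \<Longrightarrow> w $ i = c * q i" by metis
  have "w = c \<cdot>\<^sub>v vec r q" using assms(1) q by (intro eq_vecI) auto
  then show thesis using that[of "vec r q"] by simp
qed

lemma smult_vec_cancel:
  fixes c :: "'a::idom"
  assumes "c \<noteq> 0" "c \<cdot>\<^sub>v u = c \<cdot>\<^sub>v v"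
  shows "u = v"
proof (rule eq_vecI)
  show dim: "dim_vec u = dim_vec v" using arg_cong[OF assms(2), of dim_vec] by simp
  fix i assume i: "i < dim_vec v"
  have "(c \<cdot>\<^sub>v u) $ i = (c \<cdot>\<^sub>v v) $ i" using assms(2) by simp
  then show "u $ i = v $ i" using i dim assms(1) by simp
qed

section \<open>Colon modules and saturation over a gcd domain\<close>

context gcd_dom begin

text \<open>For each maximal minor \<open>x\<close>, Cramer's rule writes \<open>x\<close> times
  \<open>w\<close> through entries of \<open>c\<close> times \<open>u\<close>, so \<open>c\<close>
  divides \<open>w $ i * x\<close>; \<open>dvd_scaled_gcd\<close> then replaces \<open>x\<close> by
  the gcd \<open>e\<close>.\<close>

lemma coeff_dvd_of_multiple:
  fixes F :: "'a mat"
  assumes F: "F \<in> carrier_mat r m" and e: "is_gcd_of (minors r F) e"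
    and u: "u \<in> carrier_vec m" and w: "w \<in> carrier_vec r"
    and eq: "c \<cdot>\<^sub>v u = transpose_mat F *\<^sub>v w" and i: "i < r"
  shows "c dvd w $ i * e"
proof (rule dvd_scaled_gcd[OF finite_minors e])
  fix x assume "x \<in> minors r F"
  then obtain s where s: "\<And>k. k < r \<Longrightarrow> s k < m" "x = det (select_cols F s)"
    using minors_select_cols[OF F] by blast
  let ?B = "transpose_mat (adj_mat (select_cols F s))"
  have B: "?B \<in> carrier_mat r r" using adj_mat(1)[of "select_cols F s" r] F by simp
  have "vec r (\<lambda>k. (transpose_mat F *\<^sub>v w) $ s k) = c \<cdot>\<^sub>v vec r (\<lambda>k. u $ s k)"
    unfolding eq[symmetric] using u s(1) by (intro eq_vecI) auto
  then have "x \<cdot>\<^sub>v w = ?B *\<^sub>v (c \<cdot>\<^sub>v vec r (\<lambda>k. u $ s k))"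
    using det_select_cols_smult_vec[OF F s(1) w] s(2) by simp
  also have "\<dots> = c \<cdot>\<^sub>v (?B *\<^sub>v vec r (\<lambda>k. u $ s k))"
    using B by (intro mult_mat_vec_smult[where nr = r and nc = r]) auto
  finally have "(x \<cdot>\<^sub>v w) $ i = (c \<cdot>\<^sub>v (?B *\<^sub>v vec r (\<lambda>k. u $ s k))) $ i" by simp
  moreover have "(x \<cdot>\<^sub>v w) $ i = x * w $ i" using w i by simp
  moreover have "(c \<cdot>\<^sub>v (?B *\<^sub>v vec r (\<lambda>k. u $ s k))) $ i = c * (?B *\<^sub>v vec r (\<lambda>k. u $ s k)) $ i"
    using B i by (intro index_smult_vec) simp
  ultimately have "w $ i * x = c * (?B *\<^sub>v vec r (\<lambda>k. u $ s k)) $ i"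
    by (simp only: mult.commute[of "w $ i"])
  then show "c dvd w $ i * x" by (rule dvdI)
qed

text \<open>If \<open>w\<close> are the coefficients of \<open>d f u\<close>, then
  \<open>d f\<close> divides every \<open>w $ i * d\<close>, so \<open>f\<close> divides
  \<open>w\<close> and cancels.\<close>

lemma colon_saturated:
  fixes F :: "'a mat"
  assumes F: "F \<in> carrier_mat r m" and d: "is_gcd_of (minors r F) d" "d \<noteq> 0"
    and u: "u \<in> carrier_vec m" and f: "f \<noteq> 0" "f \<cdot>\<^sub>v u \<in> colon m (row_module F) d"
  shows "u \<in> colon m (row_module F) d"
proof -
  obtain w where w: "w \<in> carrier_vec r" "d \<cdot>\<^sub>v (f \<cdot>\<^sub>v u) = transpose_mat F *\<^sub>v w"
    using f(2) unfolding colon_def row_module_conv[OF F] by blast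
  have "f dvd w $ i" if "i < r" for i
  proof -
    have "(d * f) \<cdot>\<^sub>v u = transpose_mat F *\<^sub>v w" using w(2) by (simp add: smult_smult_assoc)
    then have "d * f dvd w $ i * d" by (rule coeff_dvd_of_multiple[OF F d(1) u w(1) _ that])
    then have "d * f dvd d * w $ i" by (simp only: mult.commute)
    then show ?thesis using d(2) by simp
  qed
  then obtain v where v: "v \<in> carrier_vec r" "w = f \<cdot>\<^sub>v v" using vec_dvd_factor w(1) by blast
  have "transpose_mat F *\<^sub>v (f \<cdot>\<^sub>v v) = f \<cdot>\<^sub>v (transpose_mat F *\<^sub>v v)"
    using F v(1) by (intro mult_mat_vec_smult[where nr = m and nc = r]) auto
  then have "f \<cdot>\<^sub>v (d \<cdot>\<^sub>v u) = f \<cdot>\<^sub>v (transpose_mat F *\<^sub>v v)"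
    using w(2) v(2) by (simp add: smult_smult_assoc mult.commute)
  then have "d \<cdot>\<^sub>v u = transpose_mat F *\<^sub>v v" using f(1) smult_vec_cancel by blast
  then show ?thesis using u v(1) unfolding colon_def row_module_conv[OF F] by blast
qed

text \<open>From left to right, the coefficients of \<open>d u\<close> with respect to
  \<open>F\<^sub>0\<close> are divisible by \<open>d\<close> because \<open>e\<close> is a unit.
  From right to left, \<open>det G\<^sub>1\<close> divides \<open>d\<close>, so \<open>d\<close>
  clears the denominators of the inverse of \<open>G\<^sub>1\<close>.\<close>

lemma colon_eq_row_module:
  fixes G\<^sub>1 F\<^sub>0 :: "'a mat"
  assumes G: "G\<^sub>1 \<in> carrier_mat r r" and F0: "F\<^sub>0 \<in> carrier_mat r m"
    and d: "is_gcd_of (minors r (G\<^sub>1 * F\<^sub>0)) d" "d \<noteq> 0"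
    and e: "is_gcd_of (minors r F\<^sub>0) e" "e dvd 1"
  shows "colon m (row_module (G\<^sub>1 * F\<^sub>0)) d = row_module F\<^sub>0"
proof -
  have F1: "G\<^sub>1 * F\<^sub>0 \<in> carrier_mat r m" using G F0 by simp
  have T: "transpose_mat (G\<^sub>1 * F\<^sub>0) *\<^sub>v w = transpose_mat F\<^sub>0 *\<^sub>v (transpose_mat G\<^sub>1 *\<^sub>v w)"
    if "w \<in> carrier_vec r" for w
    using G F0 that by (simp add: transpose_mult[OF G F0])
  have "det G\<^sub>1 dvd x" if x: "x \<in> minors r (G\<^sub>1 * F\<^sub>0)" for x
  proof -
    obtain s where "\<And>k. k < r \<Longrightarrow> s k < m" "x = det (select_cols (G\<^sub>1 * F\<^sub>0) s)"
      using minors_select_cols[OF F1 x] by blast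
    then show ?thesis using det_select_cols_mult[OF G F0] by simp
  qed
  then have "det G\<^sub>1 dvd d" using d(1) unfolding is_gcd_of_def by blast
  then obtain c where c: "d = det G\<^sub>1 * c" by (rule dvdE)
  show ?thesis
  proof (intro equalityI subsetI)
    fix u assume "u \<in> colon m (row_module (G\<^sub>1 * F\<^sub>0)) d"
    then obtain v where u: "u \<in> carrier_vec m" and v: "v \<in> carrier_vec r"
      "d \<cdot>\<^sub>v u = transpose_mat (G\<^sub>1 * F\<^sub>0) *\<^sub>v v"
      unfolding colon_def row_module_conv[OF F1] by blast
    let ?w = "transpose_mat G\<^sub>1 *\<^sub>v v"
    have w: "?w \<in> carrier_vec r" "d \<cdot>\<^sub>v u = transpose_mat F\<^sub>0 *\<^sub>v ?w" using G v T by auto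
    have "d dvd ?w $ i" if "i < r" for i
    proof -
      have "d dvd ?w $ i * e" using coeff_dvd_of_multiple[OF F0 e(1) u w that] .
      also have "?w $ i * e dvd ?w $ i * 1" using e(2) by (intro mult_dvd_mono) auto
      finally show ?thesis by simp
    qed
    then obtain y where y: "y \<in> carrier_vec r" "?w = d \<cdot>\<^sub>v y" using vec_dvd_factor w(1) by blast
    have "d \<cdot>\<^sub>v u = d \<cdot>\<^sub>v (transpose_mat F\<^sub>0 *\<^sub>v y)"
      using w(2) F0 y by (simp add: mult_mat_vec_smult[where nr = m and nc = r])
    then have "u = transpose_mat F\<^sub>0 *\<^sub>v y" using d(2) smult_vec_cancel by blast
    then show "u \<in> row_module F\<^sub>0" using y unfolding row_module_conv[OF F0] by blast
  next
    fix u assume "u \<in> row_module F\<^sub>0"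
    then obtain w where w: "w \<in> carrier_vec r" "u = transpose_mat F\<^sub>0 *\<^sub>v w"
      unfolding row_module_conv[OF F0] by blast
    \<comment> \<open>Chosen so that the transpose of \<open>G\<^sub>1\<close> sends it to
      \<open>c * det G\<^sub>1 = d\<close> times \<open>w\<close>.\<close>
    let ?v = "c \<cdot>\<^sub>v (transpose_mat (adj_mat G\<^sub>1) *\<^sub>v w)"
    have adj: "adj_mat G\<^sub>1 \<in> carrier_mat r r" using adj_mat(1)[OF G] .
    have v: "?v \<in> carrier_vec r" using adj w by simp
    have "transpose_mat G\<^sub>1 *\<^sub>v ?v = c \<cdot>\<^sub>v (transpose_mat G\<^sub>1 *\<^sub>v (transpose_mat (adj_mat G\<^sub>1) *\<^sub>v w))"
      using G adj w by (intro mult_mat_vec_smult[where nr = r and nc = r]) auto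
    also have "transpose_mat G\<^sub>1 *\<^sub>v (transpose_mat (adj_mat G\<^sub>1) *\<^sub>v w) = transpose_mat (adj_mat G\<^sub>1 * G\<^sub>1) *\<^sub>v w"
      using G adj w by (simp add: transpose_mult[OF adj G])
    also have "transpose_mat (adj_mat G\<^sub>1 * G\<^sub>1) = det G\<^sub>1 \<cdot>\<^sub>m 1\<^sub>m r"
      unfolding adj_mat(3)[OF G] by (rule eq_matI) auto
    also have "\<dots> *\<^sub>v w = det G\<^sub>1 \<cdot>\<^sub>v w" by (rule smult_one_mat_mult_vec[OF w(1)])
    finally have "transpose_mat G\<^sub>1 *\<^sub>v ?v = d \<cdot>\<^sub>v w"
      by (simp add: c smult_smult_assoc mult.commute)
    then have "transpose_mat (G\<^sub>1 * F\<^sub>0) *\<^sub>v ?v = d \<cdot>\<^sub>v u"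
      using T[OF v] w F0 by (simp add: mult_mat_vec_smult[where nr = m and nc = r])
    then have "d \<cdot>\<^sub>v u \<in> row_module (G\<^sub>1 * F\<^sub>0)" using row_moduleI[OF F1 v] by simp
    moreover have "u \<in> carrier_vec m" using w F0 by simp
    ultimately show "u \<in> colon m (row_module (G\<^sub>1 * F\<^sub>0)) d"
      unfolding colon_def by simp
  qed
qed

lemma saturated_minor_gcd_unit:
  fixes F :: "'a mat"
  assumes F: "F \<in> carrier_mat r m"
    and inj: "\<And>w. w \<in> carrier_vec r \<Longrightarrow> transpose_mat F *\<^sub>v w = 0\<^sub>v m \<Longrightarrow> w = 0\<^sub>v r"
    and sat: "\<And>f u. u \<in> carrier_vec m \<Longrightarrow> f \<noteq> 0 \<Longrightarrow> f \<cdot>\<^sub>v u \<in> row_module F \<Longrightarrow> u \<in> row_module F"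
    and e: "is_gcd_of (minors r F) e" "e \<noteq> 0"
  shows "e dvd 1"
proof (rule ccontr)
  assume nonunit: "\<not> e dvd 1"
  have e_minors: "e dvd x" if "x \<in> minors r F" for x
    using e(1) that unfolding is_gcd_of_def by blast
  \<comment> \<open>Needed for arbitrary selections, since the entries of the adjugate times
    \<open>F\<close> have the form \<open>s(i := j)\<close>.\<close>
  have e_dvd: "e dvd det (select_cols F s)" if "\<And>k. k < r \<Longrightarrow> s k < m" for s
    by (rule dvd_det_select_cols[OF F]) (use that e_minors in auto)
  \<comment> \<open>\<open>q x\<close> is the quotient \<open>x / e\<close>, used for maximal minors
    \<open>x\<close>.\<close>
  define q where "q x = (SOME y. x = e * y)" for x
  have q: "x = e * q x" if "x \<in> minors r F" for x
  proof -
    have "e dvd x" using e_minors that .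
    then have "\<exists>y. x = e * y" unfolding dvd_def .
    then show ?thesis unfolding q_def by (rule someI_ex)
  qed
  have "e dvd y ^ r" if y: "y \<in> q ` minors r F" for y
  proof -
    obtain x where x: "x \<in> minors r F" "x = e * y" using y q by blast
    obtain s where s: "\<And>k. k < r \<Longrightarrow> s k < m" "x = det (select_cols F s)"
      using minors_select_cols[OF F x(1)] by blast
    let ?A = "select_cols F s"
    have A: "?A \<in> carrier_mat r r" using F by simp
    have adj: "adj_mat ?A \<in> carrier_mat r r" using adj_mat(1)[OF A] .
    \<comment> \<open>Row \<open>i\<close> of the adjugate combines the rows of \<open>F\<close>
      into a vector \<open>e u\<close>. Saturation puts \<open>u\<close> into the row module with
      coefficients \<open>v\<close>, and uniqueness of coefficients makes the adjugate row equal to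
      \<open>e v\<close>.\<close>
    have entry: "e dvd adj_mat ?A $$ (i, k)" if ik: "i < r" "k < r" for i k
    proof -
      let ?w = "row (adj_mat ?A) i"
      have w: "?w \<in> carrier_vec r" using adj ik by simp
      have idx: "(transpose_mat F *\<^sub>v ?w) $ j = det (select_cols F (s(i := j)))" if "j < m" for j
      proof -
        have "(transpose_mat F *\<^sub>v ?w) $ j = (adj_mat ?A * F) $$ (i, j)"
          using F adj ik that by (simp add: comm_scalar_prod[of _ r])
        then show ?thesis using adj_mat_mult_index[OF F s(1) ik(1) that] by simp
      qed
      have "e dvd (transpose_mat F *\<^sub>v ?w) $ j" if "j < m" for j
        unfolding idx[OF that] using s(1) that by (intro e_dvd) auto
      moreover have "transpose_mat F *\<^sub>v ?w \<in> carrier_vec m" using F w by simp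
      ultimately obtain u where u: "u \<in> carrier_vec m" "transpose_mat F *\<^sub>v ?w = e \<cdot>\<^sub>v u"
        using vec_dvd_factor by blast
      have "e \<cdot>\<^sub>v u \<in> row_module F" using row_moduleI[OF F w] u(2) by simp
      then have "u \<in> row_module F" using sat u(1) e(2) by blast
      then obtain v where v: "v \<in> carrier_vec r" "u = transpose_mat F *\<^sub>v v"
        unfolding row_module_conv[OF F] by blast
      have "transpose_mat F *\<^sub>v (?w - e \<cdot>\<^sub>v v) = transpose_mat F *\<^sub>v ?w - transpose_mat F *\<^sub>v (e \<cdot>\<^sub>v v)"
        using F w v by (intro mult_minus_distrib_mat_vec) auto
      also have "transpose_mat F *\<^sub>v (e \<cdot>\<^sub>v v) = e \<cdot>\<^sub>v u"
        unfolding v(2) using F v by (intro mult_mat_vec_smult[where nr = m and nc = r]) auto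
      also have "transpose_mat F *\<^sub>v ?w - e \<cdot>\<^sub>v u = 0\<^sub>v m" using u by simp
      finally have "?w - e \<cdot>\<^sub>v v = 0\<^sub>v r" using inj w v by simp
      then have "(?w - e \<cdot>\<^sub>v v) $ k = 0" using ik by simp
      then have "adj_mat ?A $$ (i, k) = e * v $ k" using w v ik adj by simp
      then show ?thesis by (rule dvdI)
    qed
    then have "\<forall>i k. \<exists>z. i < r \<longrightarrow> k < r \<longrightarrow> adj_mat ?A $$ (i, k) = e * z" unfolding dvd_def by blast
    then obtain z where z: "\<And>i k. i < r \<Longrightarrow> k < r \<Longrightarrow> adj_mat ?A $$ (i, k) = e * z i k" by metis
    have "adj_mat ?A = e \<cdot>\<^sub>m mat r r (\<lambda>(i, k). z i k)"
      using adj z by (intro eq_matI) auto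
    then have "det (adj_mat ?A) = e ^ r * det (mat r r (\<lambda>(i, k). z i k))" by simp
    \<comment> \<open>Since \<open>det ?A = e * y\<close> and the adjugate has determinant
      \<open>e ^ r\<close> times another, both sides contain \<open>e ^ r\<close>; cancelling it
      leaves \<open>y ^ r\<close> as a multiple of \<open>e\<close>.\<close>
    moreover have "det ?A * det (adj_mat ?A) = det ?A ^ r"
      using det_mult[OF A adj] adj_mat(2)[OF A] by simp
    ultimately have "e ^ r * (e * (y * det (mat r r (\<lambda>(i, k). z i k)))) = e ^ r * y ^ r"
      using x(2) s(2) by (simp add: power_mult_distrib algebra_simps)
    then have "y ^ r = e * (y * det (mat r r (\<lambda>(i, k). z i k)))" using e(2) by simp
    then show ?thesis by (rule dvdI)
  qed
  then obtain g where g: "\<not> g dvd 1" "\<forall>y\<in>q ` minors r F. g dvd y"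
    using nonunit_common_divisor_powers[of "q ` minors r F" e r] finite_minors nonunit by blast
  have "e * g dvd x" if "x \<in> minors r F" for x
  proof -
    have "e * g dvd e * q x" using g(2) that by (intro mult_dvd_mono) auto
    then show ?thesis using q[OF that] by simp
  qed
  \<comment> \<open>A nonunit \<open>g\<close> common to all quotients makes \<open>e * g\<close> a
    common divisor of the maximal minors, so it divides their gcd.\<close>
  then have "e * g dvd e" using e(1) unfolding is_gcd_of_def by blast
  then have "e * g dvd e * 1" by simp
  then have "g dvd 1" using e(2) by (simp only: dvd_mult_cancel_left) simp
  then show False using g(1) by blast
qed

end

section \<open>Minor left prime factorizations\<close>

lemma index_submatrix_rows:
  assumes A: "A \<in> carrier_mat l m" and I: "I \<subseteq> {..<l}" "card I = r"
  shows "submatrix A I UNIV \<in> carrier_mat r m"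
    and "t < r \<Longrightarrow> j < m \<Longrightarrow> submatrix A I UNIV $$ (t, j) = A $$ (pick I t, j)"
proof -
  have set_eq: "{i. i < dim_row A \<and> i \<in> I} = I" using A I by auto
  have card_eq: "card {i. i < dim_col A \<and> i \<in> UNIV} = m" using A by simp
  show "submatrix A I UNIV \<in> carrier_mat r m"
    by (rule carrier_matI) (simp_all only: dim_submatrix set_eq card_eq I)
  show "submatrix A I UNIV $$ (t, j) = A $$ (pick I t, j)" if "t < r" "j < m"
    using submatrix_index[of t A I j UNIV] that unfolding set_eq card_eq I pick_UNIV by simp
qed

lemma submatrix_rows_mult:
  assumes G: "G \<in> carrier_mat l n" and F: "F \<in> carrier_mat n m" and I: "I \<subseteq> {..<l}" "card I = r"
  shows "submatrix (G * F) I UNIV = submatrix G I UNIV * F"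
proof -
  have GF: "G * F \<in> carrier_mat l m" using G F by simp
  note idx = index_submatrix_rows[OF GF I] index_submatrix_rows[OF G I]
  have "submatrix (G * F) I UNIV $$ (t, j) = (submatrix G I UNIV * F) $$ (t, j)"
    if "t < r" "j < m" for t j
    using idx G F that pick_less[OF I that(1)] by (simp add: scalar_prod_def)
  then show ?thesis using idx(1,3) F by (intro eq_matI) auto
qed

text \<open>Cramer's rule solves for coefficients \<open>w\<close> that reproduce the multiple of
  row \<open>i\<close> in the columns \<open>s\<close>; as the rank is \<open>r\<close>, the
  relation extends to all columns.\<close>

lemma multiple_of_row_in_row_module:
  fixes F :: "'a::idom mat"
  assumes F: "F \<in> carrier_mat l m" and rank: "fract_rank F = r"
    and I: "I \<subseteq> {..<l}" "card I = r" and s: "\<And>k. k < r \<Longrightarrow> s k < m"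
    and det: "det (select_cols (submatrix F I UNIV) s) \<noteq> 0" and i: "i < l"
  shows "det (select_cols (submatrix F I UNIV) s) \<cdot>\<^sub>v row F i \<in> row_module (submatrix F I UNIV)"
proof -
  define F\<^sub>1 where "F\<^sub>1 = submatrix F I UNIV"
  have F1: "F\<^sub>1 \<in> carrier_mat r m" and idx: "\<And>t j. t < r \<Longrightarrow> j < m \<Longrightarrow> F\<^sub>1 $$ (t, j) = F $$ (pick I t, j)"
    unfolding F\<^sub>1_def using index_submatrix_rows[OF F I] by blast+
  let ?A = "select_cols F\<^sub>1 s"
  let ?D = "det ?A"
  have A: "?A \<in> carrier_mat r r" using F1 by simp
  have adj: "adj_mat ?A \<in> carrier_mat r r" using adj_mat(1)[OF A] .
  let ?v = "vec r (\<lambda>k. F $$ (i, s k))"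
  define w where "w = transpose_mat (adj_mat ?A) *\<^sub>v ?v"
  have w: "w \<in> carrier_vec r" unfolding w_def using adj by simp
  have "transpose_mat ?A *\<^sub>v w = transpose_mat (adj_mat ?A * ?A) *\<^sub>v ?v"
    unfolding w_def transpose_mult[OF adj A] using A adj
    by (intro assoc_mult_mat_vec[symmetric, of _ r r _ r]) auto
  also have "transpose_mat (adj_mat ?A * ?A) = ?D \<cdot>\<^sub>m 1\<^sub>m r"
    unfolding adj_mat(3)[OF A] by (rule eq_matI) auto
  also have "\<dots> *\<^sub>v ?v = ?D \<cdot>\<^sub>v ?v" by (rule smult_one_mat_mult_vec) simp
  finally have Aw: "transpose_mat ?A *\<^sub>v w = ?D \<cdot>\<^sub>v ?v" .
  have sel: "?A = mat r r (\<lambda>(t, k). F $$ (pick I t, s k))"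
    using F1 idx s by (intro eq_matI) (auto simp: select_cols_def)
  have eqk: "?D * F $$ (i, s k) = (\<Sum>t<r. w $ t * F $$ (pick I t, s k))" if k: "k < r" for k
  proof -
    have "?D * F $$ (i, s k) = (transpose_mat ?A *\<^sub>v w) $ k" unfolding Aw using k by simp
    also have "\<dots> = (\<Sum>t<r. ?A $$ (t, k) * w $ t)"
      by (rule mult_mat_vec_transpose_index[OF A w k])
    also have "\<dots> = (\<Sum>t<r. w $ t * F $$ (pick I t, s k))"
      unfolding sel using k by (intro sum.cong) (auto simp: mult.commute)
    finally show ?thesis .
  qed
  have det': "det (mat r r (\<lambda>(t, k). F $$ (pick I t, s k))) \<noteq> 0"
    using det unfolding F\<^sub>1_def[symmetric] sel .
  have "?D * F $$ (i, j) = (\<Sum>t<r. w $ t * F $$ (pick I t, j))" if j: "j < m" for j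
    by (rule row_combination_extends[OF F rank pick_less[OF I] s det' i j eqk])
  then have "?D * F $$ (i, j) = (transpose_mat F\<^sub>1 *\<^sub>v w) $ j" if "j < m" for j
    using that idx unfolding mult_mat_vec_transpose_index[OF F1 w that]
    by (simp add: mult.commute)
  then have "?D \<cdot>\<^sub>v row F i = transpose_mat F\<^sub>1 *\<^sub>v w"
    using F F1 w i by (intro eq_vecI) (auto simp del: index_mult_mat_vec)
  then show ?thesis using row_moduleI[OF F1 w] unfolding F\<^sub>1_def[symmetric] by simp
qed

lemma row_module_subset_colon:
  fixes F :: "'a::idom mat"
  assumes F: "F \<in> carrier_mat r m"
  shows "row_module F \<subseteq> colon m (row_module F) d"
proof
  fix u assume "u \<in> row_module F"
  then obtain w where w: "w \<in> carrier_vec r" "u = transpose_mat F *\<^sub>v w"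
    unfolding row_module_conv[OF F] by blast
  have "d \<cdot>\<^sub>v u = transpose_mat F *\<^sub>v (d \<cdot>\<^sub>v w)"
    unfolding w(2) using F w(1) by (intro mult_mat_vec_smult[symmetric, where nr = m and nc = r]) auto
  then have "d \<cdot>\<^sub>v u \<in> row_module F" using row_moduleI[OF F, of "d \<cdot>\<^sub>v w"] w(1) by simp
  then show "u \<in> colon m (row_module F) d" unfolding colon_def using F w by simp
qed

lemma mat_factorization:
  fixes F :: "'a::idom mat"
  assumes F: "F \<in> carrier_mat l m" and F0: "F\<^sub>0 \<in> carrier_mat r m"
    and rows: "\<And>i. i < l \<Longrightarrow> row F i \<in> row_module F\<^sub>0"
  shows "\<exists>G\<in>carrier_mat l r. F = G * F\<^sub>0"
proof -
  have "\<forall>i. \<exists>g. i < l \<longrightarrow> g \<in> carrier_vec r \<and> row F i = transpose_mat F\<^sub>0 *\<^sub>v g"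
    using rows unfolding row_module_conv[OF F0] by blast
  then obtain g where g: "\<And>i. i < l \<Longrightarrow> g i \<in> carrier_vec r \<and> row F i = transpose_mat F\<^sub>0 *\<^sub>v g i"
    by metis
  let ?G = "mat l r (\<lambda>(i, t). g i $ t)"
  have "F $$ (i, j) = (?G * F\<^sub>0) $$ (i, j)" if ij: "i < l" "j < m" for i j
  proof -
    have "F $$ (i, j) = (transpose_mat F\<^sub>0 *\<^sub>v g i) $ j"
      using g[OF ij(1)] F ij by (metis carrier_matD index_row(1))
    also have "\<dots> = (\<Sum>t<r. F\<^sub>0 $$ (t, j) * g i $ t)"
      using mult_mat_vec_transpose_index[OF F0 _ ij(2)] g[OF ij(1)] by blast
    also have "\<dots> = (?G * F\<^sub>0) $$ (i, j)"
      using ij F0 by (simp add: scalar_prod_def lessThan_atLeast0 mult.commute)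
    finally show ?thesis .
  qed
  then have "F = ?G * F\<^sub>0" using F F0 by (intro eq_matI) auto
  then show ?thesis by (intro bexI[of _ ?G]) auto
qed

lemma (in gcd_dom) minor_gcd_is_gcd: "is_gcd_of (minors i A) (minor_gcd i (A :: 'a mat))"
  unfolding minor_gcd_def by (rule someI_ex) (rule finite_gcd_ex[OF finite_minors])

lemma (in gcd_dom) minor_gcd_nonzero:
  fixes A :: "'a mat"
  assumes A: "A \<in> carrier_mat r m" and s: "\<And>k. k < r \<Longrightarrow> s k < m" and det: "det (select_cols A s) \<noteq> 0"
  shows "minor_gcd r A \<noteq> 0"
proof
  assume "minor_gcd r A = 0"
  then have zero: "0 dvd x" if "x \<in> minors r A" for x
    using minor_gcd_is_gcd[of r A] that unfolding is_gcd_of_def by auto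
  have "0 dvd det (select_cols A s)" by (rule dvd_det_select_cols[OF A s zero])
  then show False using det by simp
qed

theorem theorem10:
  fixes F F\<^sub>1 :: "('v::{finite,linorder}, 'k::alg_closed_field) mpolynomial mat"
    and l m r :: nat
    and I :: "nat set"
  assumes "CARD('v) \<ge> 3"
    and "0 < l" and "l \<le> m"
    and "F \<in> carrier_mat l m"
    and "fract_rank F = r" and "1 \<le> r" and "r \<le> l"
    and "I \<subseteq> {..<l}" and "card I = r"
    and "F\<^sub>1 = submatrix F I UNIV"
    and "full_row_rank F\<^sub>1"
  shows "has_mlp_factorization F \<longleftrightarrow>
    free_of_rank m (colon m (row_module F\<^sub>1) (minor_gcd r F\<^sub>1)) r"
proof -
  interpret gcd_dom "TYPE(('v, 'k) mpolynomial)" by (rule gcd_dom_mpolynomial)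
  note F = \<open>F \<in> carrier_mat l m\<close> and I = \<open>I \<subseteq> {..<l}\<close> \<open>card I = r\<close>
  note F1_def = \<open>F\<^sub>1 = submatrix F I UNIV\<close>
  have F1: "F\<^sub>1 \<in> carrier_mat r m" unfolding F1_def by (rule index_submatrix_rows(1)[OF F I])
  obtain s where s: "\<And>k. k < r \<Longrightarrow> s k < m" and det1: "det (select_cols F\<^sub>1 s) \<noteq> 0"
    using \<open>full_row_rank F\<^sub>1\<close> unfolding full_row_rank_iff_minor[OF F1] by blast
  let ?d = "minor_gcd r F\<^sub>1"
  have d: "is_gcd_of (minors r F\<^sub>1) ?d" "?d \<noteq> 0"
    using minor_gcd_is_gcd minor_gcd_nonzero[OF F1 s det1] by blast+
  \<comment> \<open>The selected minor of \<open>F\<^sub>1\<close> is \<open>det G\<close> times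
    that of \<open>F\<^sub>0\<close>. The nonzero minor gives independence of the rows of
    \<open>F\<^sub>0\<close> in one direction and full row rank in the other.\<close>
  have det0: "det (select_cols F\<^sub>0 s) \<noteq> 0"
    if "G \<in> carrier_mat r r" "F\<^sub>0 \<in> carrier_mat r m" "F\<^sub>1 = G * F\<^sub>0" for G F\<^sub>0
    using det1 det_select_cols_mult[OF that(1,2) s] unfolding that(3) by auto
  have factor1: "submatrix G I UNIV \<in> carrier_mat r r" "F\<^sub>1 = submatrix G I UNIV * F\<^sub>0"
    if "G \<in> carrier_mat l r" "F\<^sub>0 \<in> carrier_mat r m" "F = G * F\<^sub>0" for G F\<^sub>0
    using index_submatrix_rows(1)[OF that(1) I] submatrix_rows_mult[OF that(1,2) I]
    unfolding F1_def that(3) by blast+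
  show ?thesis
  proof
    assume "has_mlp_factorization F"
    then obtain G\<^sub>0 F\<^sub>0 where G0: "G\<^sub>0 \<in> carrier_mat l r" and F0: "F\<^sub>0 \<in> carrier_mat r m"
      and mlp: "minor_left_prime F\<^sub>0" and FGF: "F = G\<^sub>0 * F\<^sub>0"
      using F \<open>fract_rank F = r\<close> unfolding has_mlp_factorization_def by auto
    note G1 = factor1[OF G0 F0 FGF]
    have "minor_gcd r F\<^sub>0 dvd 1"
      using mlp F0 unfolding minor_left_prime_def is_constant_iff_unit[symmetric] by simp
    then have "colon m (row_module F\<^sub>1) ?d = row_module F\<^sub>0"
      using colon_eq_row_module[OF G1(1) F0 _ _ minor_gcd_is_gcd] d unfolding G1(2) by blast
    moreover have "\<forall>w\<in>carrier_vec r. transpose_mat F\<^sub>0 *\<^sub>v w = 0\<^sub>v m \<longrightarrow> w = 0\<^sub>v r"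
      using row_combination_eq_zero[OF F0 s det0[OF G1(1) F0 G1(2)]] by blast
    ultimately show "free_of_rank m (colon m (row_module F\<^sub>1) ?d) r"
      unfolding free_of_rank_iff using F0 by blast
  next
    assume "free_of_rank m (colon m (row_module F\<^sub>1) ?d) r"
    then obtain F\<^sub>0 where F0: "F\<^sub>0 \<in> carrier_mat r m"
      and K: "row_module F\<^sub>0 = colon m (row_module F\<^sub>1) ?d"
      and inj: "\<And>w. w \<in> carrier_vec r \<Longrightarrow> transpose_mat F\<^sub>0 *\<^sub>v w = 0\<^sub>v m \<Longrightarrow> w = 0\<^sub>v r"
      unfolding free_of_rank_iff by blast
    have sat: "u \<in> row_module F\<^sub>0"
      if "u \<in> carrier_vec m" "f \<noteq> 0" "f \<cdot>\<^sub>v u \<in> row_module F\<^sub>0" for f u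
      using colon_saturated[OF F1 d that(1,2)] that(3) unfolding K .
    \<comment> \<open>A nonzero multiple of the row lies in the row module of
      \<open>F\<^sub>1\<close>, hence in the colon module, and saturation removes the
      factor.\<close>
    have "row F i \<in> row_module F\<^sub>0" if i: "i < l" for i
    proof (rule sat)
      show "row F i \<in> carrier_vec m" using F i by auto
      show "det (select_cols F\<^sub>1 s) \<cdot>\<^sub>v row F i \<in> row_module F\<^sub>0"
        using multiple_of_row_in_row_module[OF F \<open>fract_rank F = r\<close> I s det1[unfolded F1_def] i]
          row_module_subset_colon[OF F1] unfolding K F1_def by blast
    qed (rule det1)
    then obtain G\<^sub>0 where G0: "G\<^sub>0 \<in> carrier_mat l r" and FGF: "F = G\<^sub>0 * F\<^sub>0"
      using mat_factorization[OF F F0] by blast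
    note G1 = factor1[OF G0 F0 FGF]
    note det0' = det0[OF G1(1) F0 G1(2)]
    have "minor_gcd r F\<^sub>0 dvd 1"
      by (rule saturated_minor_gcd_unit[OF F0 inj sat minor_gcd_is_gcd minor_gcd_nonzero[OF F0 s det0']])
    then have "minor_gcd r F\<^sub>0 \<noteq> 0 \<and> is_constant (minor_gcd r F\<^sub>0)"
      unfolding is_constant_iff_unit .
    moreover have "full_row_rank F\<^sub>0"
      unfolding full_row_rank_iff_minor[OF F0] using s det0' by blast
    ultimately have "minor_left_prime F\<^sub>0"
      using F0 \<open>r \<le> l\<close> \<open>l \<le> m\<close> unfolding minor_left_prime_def by simp
    then show "has_mlp_factorization F"
      unfolding has_mlp_factorization_def \<open>fract_rank F = r\<close> using F G0 F0 FGF by blast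
  qed
qed

end
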